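(* Let $\Omega\subset\mathbb{R}^d$ be open and $p\in[1,+\infty)$. For all $\mu \in \mathcal{P}_p(\Omega)$, define $\xi_{\mu}: L^p(\Omega;\mu) \rightarrow TL^p(\Omega)$ by $\xi_{\mu}(u) := (u,\mu)$. Then $\big((L^p(\Omega;\mu), \xi_{\mu})_{\mu \in \mathcal{P}_p(\Omega)}, TL^p(\Omega)\big)$ is a Banach stacking, where the index set $\mathcal{P}_p(\Omega)$ carries the topology induced by the $p$-Wasserstein metric.
   Context: $\mathbb{N}=\{1,2,\dots\}$, $\mathbb{N}_\infty=\mathbb{N}\cup\{\infty\}$. For probability measures $\mu,\nu$ on $\Omega$, $\Gamma(\mu,\nu)$ is the set of probability measures on $\Omega\times\Omega$ with first marginal $\mu$ and second marginal $\nu$. $\mathcal{P}_p(\Omega)$ is the set of Borel probability measures on $\Omega$ with finite $p$-th moment, with $p$-Wasserstein metric $d_p(\mu,\nu)=\inf_{\pi\in\Gamma(\mu,\nu)}\left(\int_{\Omega\times\Omega}|x-y|^p\,d\pi(x,y)\right)^{1/p}$. $TL^p(\Omega)$ is the metric space of pairs $(u,\mu)$ with $\mu\in\mathcal{P}_p(\Omega)$ and $u\in L^p(\Omega;\mu)$, with metric $d_{TL^p(\Omega)}((u,\mu),(v,\nu))=\inf_{\pi\in\Gamma(\mu,\nu)}\left(\int_{\Omega\times\Omega}|u(x)-v(y)|^p+|x-y|^p\,d\pi(x,y)\right)^{1/p}$. Banach stacking indexed by $\mathbb{N}_\infty$: Let $(X_n,\|\cdot\|_n)_{n\in\mathbb{N}_\infty}$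 be (real) Banach spaces, $(\mathcal{M},d)$ a metric space and $\xi_n:X_n\to\mathcal{M}$ maps. For $x_n\in X_n$ ($n\in\mathbb{N}_\infty$), write $x_n\twoheadrightarrow x_\infty$ if $\xi_n(x_n)\to\xi_\infty(x_\infty)$ in $\mathcal{M}$ as $n\to\infty$. The collection $\big((X_n,\xi_n)_{n\in\mathbb{N}_\infty},\mathcal{M}\big)$ is a Banach stacking if: (i) each $\xi_n$ is $1$-Lipschitz; (ii) for all $x_\infty\in X_\infty$ there are $x_n\in X_n$ ($n\in\mathbb{N}$) with $x_n\twoheadrightarrow x_\infty$; (iii) if $x_n\twoheadrightarrow x_\infty$ and $y_n\twoheadrightarrow y_\infty$ and $\lambda\in\mathbb{R}$, then $x_n+y_n\twoheadrightarrow x_\infty+y_\infty$ and $\lambda x_n\twoheadrightarrow\lambda x_\infty$; (iv) if $x_n\twoheadrightarrow x_\infty$ then $\|x_n\|_n\to\|x_\infty\|_\infty$. Banach stacking indexed by a topological space $I$: given a metric space $\mathcal{M}$, Banach spaces $(X_i)_{i\in I}$ and maps $\xi_i:X_i\to\mathcal{M}$, $\big((X_i,\xi_i)_{i\in I},\mathcal{M}\big)$ is a Banach stacking if for every $(i_n)_{n\in\mathbb{N}_\infty}\subset I$ with $i_n\to i_\infty$ as $n\to\infty$, $\big((X_{i_n},\xi_{i_n})_{n\in\mathbb{N}_\infty},\mathcal{M}\big)$ is a Banach stacking indexed by $\mathbb{N}_\infty$, i.e. it satisfies conditions (i)–(iv) with $X_n$ and $\xi_n$ replaced by $X_{i_n}$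 and $\xi_{i_n}$ for all $n\in\mathbb{N}_\infty$. *)

theory Defs
  imports "HOL-Probability.Probability" "HOL-Algebra.Module"
begin

section \<open>Banach spaces with an explicit carrier\<close>

text \<open>
  The spaces in a Banach stacking vary with the index, so type classes cannot be used.
  Their elements share one ambient type, and vector spaces are HOL-Algebra modules over the
  field of real numbers. The multiplicative fields that the record inherits from
  rings are irrelevant.
\<close>

definition real_ring :: "real ring" where
  "real_ring = \<lparr>carrier = UNIV, mult = (*), one = 1, zero = 0, add = (+)\<rparr>"

record 'x normed = "(real, 'x) module" +
  nrm :: "'x \<Rightarrow> real"

locale banach_space = module real_ring X for X :: "('x, 'z) normed_scheme" (structure) +
  assumes nrm_eq_0_iff: "x \<in> carrier X \<Longrightarrow> nrm X x = 0 \<longleftrightarrow> x = \<zero>"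
    and nrm_nonneg: "x \<in> carrier X \<Longrightarrow> 0 \<le> nrm X x"
    and nrm_smult: "x \<in> carrier X \<Longrightarrow> nrm X (c \<odot> x) = \<bar>c\<bar> * nrm X x"
    and nrm_triangle: "x \<in> carrier X \<Longrightarrow> y \<in> carrier X \<Longrightarrow> nrm X (x \<oplus> y) \<le> nrm X x + nrm X y"
    and complete: "(\<And>n. s n \<in> carrier X) \<Longrightarrow>
      (\<And>e. 0 < e \<Longrightarrow> \<exists>N. \<forall>m\<ge>N. \<forall>n\<ge>N. nrm X (s m \<ominus> s n) < e) \<Longrightarrow>
      \<exists>x\<in>carrier X. (\<lambda>n. nrm X (s n \<ominus> x)) \<longlonglongrightarrow> 0"


section \<open>Banach stackings\<close>

text \<open>
  Families indexed by the natural numbers together with infinity are functions on \<^typ>\<open>enat\<close>.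
  Finite indices start at 0 instead of 1, which is only a shift.
\<close>

definition stack_conv ::
  "'m set \<Rightarrow> ('m \<Rightarrow> 'm \<Rightarrow> real) \<Rightarrow> (enat \<Rightarrow> 'x \<Rightarrow> 'm) \<Rightarrow> (enat \<Rightarrow> 'x) \<Rightarrow> bool" where
  "stack_conv M d \<xi> x \<longleftrightarrow>
     limitin (Metric_space.mtopology M d) (\<lambda>n. \<xi> (enat n) (x (enat n))) (\<xi> \<infinity> (x \<infinity>)) sequentially"

locale banach_stacking_seq = Metric_space M d
  for X :: "enat \<Rightarrow> ('x, 'z) normed_scheme" and \<xi> :: "enat \<Rightarrow> 'x \<Rightarrow> 'm"
    and M :: "'m set" and d :: "'m \<Rightarrow> 'm \<Rightarrow> real" +
  assumes banach: "banach_space (X n)"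
    and maps_to: "\<xi> n \<in> carrier (X n) \<rightarrow> M"
    and lipschitz: "u \<in> carrier (X n) \<Longrightarrow> v \<in> carrier (X n) \<Longrightarrow>
      d (\<xi> n u) (\<xi> n v) \<le> nrm (X n) (u \<ominus>\<^bsub>X n\<^esub> v)"
    and recovery: "u \<in> carrier (X \<infinity>) \<Longrightarrow>
      \<exists>x. (\<forall>n. x n \<in> carrier (X n)) \<and> x \<infinity> = u \<and> stack_conv M d \<xi> x"
    and add_conv: "(\<And>n. x n \<in> carrier (X n)) \<Longrightarrow> (\<And>n. y n \<in> carrier (X n)) \<Longrightarrow>
      stack_conv M d \<xi> x \<Longrightarrow> stack_conv M d \<xi> y \<Longrightarrow> stack_conv M d \<xi> (\<lambda>n. x n \<oplus>\<^bsub>X n\<^esub> y n)"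
    and smult_conv: "(\<And>n. x n \<in> carrier (X n)) \<Longrightarrow>
      stack_conv M d \<xi> x \<Longrightarrow> stack_conv M d \<xi> (\<lambda>n. c \<odot>\<^bsub>X n\<^esub> x n)"
    and nrm_conv: "(\<And>n. x n \<in> carrier (X n)) \<Longrightarrow>
      stack_conv M d \<xi> x \<Longrightarrow> (\<lambda>n. nrm (X (enat n)) (x (enat n))) \<longlonglongrightarrow> nrm (X \<infinity>) (x \<infinity>)"

locale banach_stacking = Metric_space M d
  for I :: "'i topology" and X :: "'i \<Rightarrow> ('x, 'z) normed_scheme" and \<xi> :: "'i \<Rightarrow> 'x \<Rightarrow> 'm"
    and M :: "'m set" and d :: "'m \<Rightarrow> 'm \<Rightarrow> real" +
  assumes banach: "i \<in> topspace I \<Longrightarrow> banach_space (X i)"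
    and maps_to: "i \<in> topspace I \<Longrightarrow> \<xi> i \<in> carrier (X i) \<rightarrow> M"
    and stacking_seq: "(\<And>n. j n \<in> topspace I) \<Longrightarrow>
      limitin I (\<lambda>n. j (enat n)) (j \<infinity>) sequentially \<Longrightarrow>
      banach_stacking_seq (\<lambda>n. X (j n)) (\<lambda>n. \<xi> (j n)) M d"


section \<open>Lebesgue spaces\<close>

definition Lp_funs :: "real \<Rightarrow> 'a measure \<Rightarrow> ('a \<Rightarrow> real) set" where
  "Lp_funs p \<mu> = {u \<in> borel_measurable \<mu>. integrable \<mu> (\<lambda>x. \<bar>u x\<bar> powr p)}"

definition Lp_rel :: "real \<Rightarrow> 'a measure \<Rightarrow> (('a \<Rightarrow> real) \<times> ('a \<Rightarrow> real)) set" where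
  "Lp_rel p \<mu> = {(u, v). u \<in> Lp_funs p \<mu> \<and> v \<in> Lp_funs p \<mu> \<and> (AE x in \<mu>. u x = v x)}"

text \<open>A representative of an equivalence class; the norm and the distance below do not depend
  on the choice.\<close>

definition Lp_rep :: "('a \<Rightarrow> real) set \<Rightarrow> 'a \<Rightarrow> real" where
  "Lp_rep U = (SOME u. u \<in> U)"

definition Lp :: "real \<Rightarrow> 'a measure \<Rightarrow> ('a \<Rightarrow> real) set normed" where
  "Lp p \<mu> = \<lparr>carrier = Lp_funs p \<mu> // Lp_rel p \<mu>,
     mult = undefined, one = undefined,
     zero = Lp_rel p \<mu> `` {\<lambda>x. 0},
     add = (\<lambda>U V. \<Union>u\<in>U. \<Union>v\<in>V. Lp_rel p \<mu> `` {\<lambda>x. u x + v x}),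
     smult = (\<lambda>c U. \<Union>u\<in>U. Lp_rel p \<mu> `` {\<lambda>x. c * u x}),
     nrm = (\<lambda>U. (LINT x|\<mu>. \<bar>Lp_rep U x\<bar> powr p) powr (1 / p))\<rparr>"


section \<open>Wasserstein and TL metrics\<close>

definition couplings :: "'a measure \<Rightarrow> 'b measure \<Rightarrow> ('a \<times> 'b) measure set" where
  "couplings \<mu> \<nu> = {\<pi>. prob_space \<pi> \<and> sets \<pi> = sets (\<mu> \<Otimes>\<^sub>M \<nu>) \<and>
     distr \<pi> \<mu> fst = \<mu> \<and> distr \<pi> \<nu> snd = \<nu>}"

definition prob_measures :: "real \<Rightarrow> 'a::euclidean_space set \<Rightarrow> 'a measure set" where
  "prob_measures p \<Omega> = {\<mu>. prob_space \<mu> \<and> sets \<mu> = sets (restrict_space borel \<Omega>) \<and>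
     integrable \<mu> (\<lambda>x. norm x powr p)}"

text \<open>
  \<^locale>\<open>Metric_space\<close> demands nonnegativity and symmetry on the whole type, hence the value 0
  outside the carrier sets. Inside them, all integrands are integrable.
\<close>

definition wasserstein_dist ::
  "real \<Rightarrow> 'a::euclidean_space set \<Rightarrow> 'a measure \<Rightarrow> 'a measure \<Rightarrow> real" where
  "wasserstein_dist p \<Omega> \<mu> \<nu> =
     (if \<mu> \<in> prob_measures p \<Omega> \<and> \<nu> \<in> prob_measures p \<Omega>
      then INF \<pi>\<in>couplings \<mu> \<nu>. (LINT (x, y)|\<pi>. norm (x - y) powr p) powr (1 / p)
      else 0)"

definition wasserstein_topology :: "real \<Rightarrow> 'a::euclidean_space set \<Rightarrow> 'a measure topology" where
  "wasserstein_topology p \<Omega> =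
     Metric_space.mtopology (prob_measures p \<Omega>) (wasserstein_dist p \<Omega>)"

definition TL_space ::
  "real \<Rightarrow> 'a::euclidean_space set \<Rightarrow> (('a \<Rightarrow> real) set \<times> 'a measure) set" where
  "TL_space p \<Omega> = {(U, \<mu>). \<mu> \<in> prob_measures p \<Omega> \<and> U \<in> carrier (Lp p \<mu>)}"

definition TL_dist ::
  "real \<Rightarrow> 'a::euclidean_space set \<Rightarrow> ('a \<Rightarrow> real) set \<times> 'a measure
    \<Rightarrow> ('a \<Rightarrow> real) set \<times> 'a measure \<Rightarrow> real" where
  "TL_dist p \<Omega> = (\<lambda>(U, \<mu>) (V, \<nu>).
     if (U, \<mu>) \<in> TL_space p \<Omega> \<and> (V, \<nu>) \<in> TL_space p \<Omega>
     then INF \<pi>\<in>couplings \<mu> \<nu>.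
       (LINT (x, y)|\<pi>. \<bar>Lp_rep U x - Lp_rep V y\<bar> powr p + norm (x - y) powr p) powr (1 / p)
     else 0)"

definition TL_embed :: "'a measure \<Rightarrow> ('a \<Rightarrow> real) set \<Rightarrow> ('a \<Rightarrow> real) set \<times> 'a measure" where
  "TL_embed \<mu> U = (U, \<mu>)"

end

theory Submission
  imports Defs
begin

text \<open>
  The triangle inequality for \<open>TL\<^sup>p\<close> needs plans to be glued along their common marginal. No
  disintegration is used: partitioning the middle space into countably many cells on which the graph
  of the middle function has small diameter, one couples the two plans by an explicit density so that
  their middle points share a cell; this costs an arbitrarily small error.

  Everything else rests on bounded Lipschitz functions \<open>\<phi>\<close>, which are dense in every \<open>L\<^sup>p(\<mu>)\<close>.
  Adding an \<open>L\<close>-Lipschitz \<open>\<phi>\<close> to both functions multiplies the \<open>TL\<^sup>p\<close> distance by at most \<open>1 + L\<close>, and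
  the \<open>L\<^sup>p\<close> norm is 1-Lipschitz for the \<open>TL\<^sup>p\<close> distance. Hence if \<open>(u\<^sub>n, \<mu>\<^sub>n)\<close> converges to \<open>(u, \<mu>)\<close>,
  the norm of \<open>u\<^sub>n - \<phi>\<close> in \<open>L\<^sup>p(\<mu>\<^sub>n)\<close> is asymptotically at most that of \<open>u - \<phi>\<close> in \<open>L\<^sup>p(\<mu>)\<close>. This turns
  convergence in \<open>TL\<^sup>p\<close> into norm approximation by common functions, which is compatible with sums
  and multiples although the optimal plans of two sequences differ. It also shows that distance 0
  forces equality.
\<close>

section \<open>Lebesgue spaces of functions\<close>

text \<open>The obstacle throughout is that a bound on the distance speaks about one plan only, and
  the plans that are nearly optimal for different pairs of functions are unrelated. Two devices
  avoid comparing them. First, the integrand is the p-th power of an l^p norm on the plane, so the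
  cost of a plan is itself an L^p norm and Minkowski's inequality handles every estimate on a single
  plan. Second, for an L-Lipschitz \<phi> the term |\<phi>(x) - \<phi>(y)| is at most L|x - y| and
  is absorbed by the spatial part of the integrand; such an estimate holds for every plan and so
  passes to the infimum. The factor 1 + L may be huge when \<phi> is a good approximation, but
  \<phi> is fixed before n tends to infinity. The Wasserstein distance is treated as the distance
  between zero functions, so its metric axioms are special cases. All distance estimates are made
  for functions; they carry over to classes because changing a function on a null set moves it by
  distance zero.\<close>

definition Lp_norm :: "real \<Rightarrow> 'a measure \<Rightarrow> ('a \<Rightarrow> real) \<Rightarrow> real" where
  "Lp_norm p M f = (LINT x|M. \<bar>f x\<bar> powr p) powr (1 / p)"

text \<open>Convexity of the p-th power, applied to a/A and b/B with the weights A/(A+B) and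
  B/(A+B). With A and B close to the two norms it integrates to Minkowski's inequality without
  Hoelder's; with A = B = 1 it shows that sums stay in L^p.\<close>

lemma weighted_powr_add_le:
  fixes a b A B p :: real
  assumes "1 \<le> p" "0 \<le> a" "0 \<le> b" "0 < A" "0 < B"
  shows "(a + b) powr p \<le> (A + B) powr (p - 1) * (a powr p / A powr (p - 1) + b powr p / B powr (p - 1))"
proof -
  define s t where "s = A / (A + B)" and "t = B / (A + B)"
  have st: "0 < s" "0 < t" "s + t = 1" "s \<le> 1" "t \<le> 1"
    using assms add_divide_distrib[of A B "A + B"] by (auto simp: s_def t_def)
  \<comment> \<open>When x or y vanishes, the claim reduces to \<open>r powr p \<le> r\<close> for a
    weight r in (0, 1].\<close>
  have convex: "(s * x + t * y) powr p \<le> s * x powr p + t * y powr p"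
    if xy: "0 \<le> x" "0 \<le> y" for x y
  proof -
    have le: "r powr p \<le> r" if "0 < r" "r \<le> 1" for r
      using powr_mono'[of 1 p r] that \<open>1 \<le> p\<close> by simp
    consider "x = 0" | "y = 0" | "0 < x" "0 < y" using xy by linarith
    then show ?thesis
    proof cases
      case 1
      then show ?thesis
        using mult_right_mono[OF le[of t], of "y powr p"] st xy assms by (simp add: powr_mult)
    next
      case 2
      then show ?thesis
        using mult_right_mono[OF le[of s], of "x powr p"] st xy assms by (simp add: powr_mult)
    next
      case 3
      then show ?thesis
        using convex_onD[OF powr_convex[OF \<open>1 \<le> p\<close>], of t x y] st
        by (simp add: eq_diff_eq[symmetric])
    qed
  qed
  have pow: "x powr p = x * x powr (p - 1)" if "0 < x" for x :: real
    using that by (simp add: powr_diff)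
  have "(a + b) powr p = (A + B) powr p * ((a + b) / (A + B)) powr p"
    using assms by (simp add: powr_divide)
  also have "(a + b) / (A + B) = s * (a / A) + t * (b / B)"
    using assms by (simp add: s_def t_def add_divide_distrib)
  also have "(A + B) powr p * (s * (a / A) + t * (b / B)) powr p
      \<le> (A + B) powr p * (s * (a / A) powr p + t * (b / B) powr p)"
    using assms by (intro mult_left_mono convex) auto
  also have "\<dots> = (A + B) powr (p - 1) * ((A + B) * s * (a / A) powr p + (A + B) * t * (b / B) powr p)"
    using assms pow[of "A + B"] by (simp add: algebra_simps)
  also have "(A + B) * s * (a / A) powr p = a powr p / A powr (p - 1)"
    using assms pow[of A] by (simp add: s_def powr_divide)
  also have "(A + B) * t * (b / B) powr p = b powr p / B powr (p - 1)"
    using assms pow[of B] by (simp add: t_def powr_divide)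
  finally show ?thesis .
qed

lemma Lp_funs_measurable: "f \<in> Lp_funs p M \<Longrightarrow> f \<in> borel_measurable M"
  and Lp_funs_integrable: "f \<in> Lp_funs p M \<Longrightarrow> integrable M (\<lambda>x. \<bar>f x\<bar> powr p)"
  by (auto simp: Lp_funs_def)

lemma Lp_norm_nonneg: "0 \<le> Lp_norm p M f"
  by (simp add: Lp_norm_def)

lemma Lp_norm_powr:
  assumes "1 \<le> p"
  shows "Lp_norm p M f powr p = (LINT x|M. \<bar>f x\<bar> powr p)"
  using assms by (simp add: Lp_norm_def powr_powr)

lemma Lp_norm_le_iff:
  assumes "1 \<le> p" "0 \<le> c"
  shows "Lp_norm p M f \<le> c \<longleftrightarrow> (LINT x|M. \<bar>f x\<bar> powr p) \<le> c powr p"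
proof -
  have "Lp_norm p M f \<le> c \<longleftrightarrow> Lp_norm p M f powr p \<le> c powr p"
    using powr_less_mono2[of p c "Lp_norm p M f"] powr_mono2[of p "Lp_norm p M f" c] assms
      Lp_norm_nonneg[of p M f] by linarith
  then show ?thesis by (simp add: Lp_norm_powr assms)
qed

lemma Lp_funs_mono:
  assumes "g \<in> Lp_funs p M" "f \<in> borel_measurable M" "AE x in M. \<bar>f x\<bar> \<le> \<bar>g x\<bar>" "1 \<le> p"
  shows "f \<in> Lp_funs p M"
proof -
  have "integrable M (\<lambda>x. \<bar>f x\<bar> powr p)"
    using Lp_funs_integrable[OF assms(1)]
    by (rule Bochner_Integration.integrable_bound)
      (use assms in \<open>auto elim!: eventually_mono intro!: powr_mono2\<close>)
  then show ?thesis using assms by (simp add: Lp_funs_def)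
qed

lemma Lp_norm_mono:
  assumes "g \<in> Lp_funs p M" "f \<in> borel_measurable M" "AE x in M. \<bar>f x\<bar> \<le> \<bar>g x\<bar>" "1 \<le> p"
  shows "Lp_norm p M f \<le> Lp_norm p M g"
  unfolding Lp_norm_def
  using assms Lp_funs_integrable Lp_funs_mono[OF assms]
  by (intro powr_mono2 integral_mono_AE integral_nonneg) (auto elim!: eventually_mono intro!: powr_mono2)

lemma Lp_norm_cong_AE:
  assumes "f \<in> borel_measurable M" "g \<in> borel_measurable M" "AE x in M. \<bar>f x\<bar> = \<bar>g x\<bar>"
  shows "Lp_norm p M f = Lp_norm p M g"
proof -
  have "(LINT x|M. \<bar>f x\<bar> powr p) = (LINT x|M. \<bar>g x\<bar> powr p)"
    using assms by (intro integral_cong_AE) auto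
  then show ?thesis by (simp add: Lp_norm_def)
qed

lemma Lp_norm_cong: "(\<And>x. x \<in> space M \<Longrightarrow> \<bar>f x\<bar> = \<bar>g x\<bar>) \<Longrightarrow> Lp_norm p M f = Lp_norm p M g"
  unfolding Lp_norm_def by (metis (mono_tags, lifting) Bochner_Integration.integral_cong)

lemma
  assumes "T \<in> M \<rightarrow>\<^sub>M N" "f \<in> borel_measurable N" "sets N' = sets N"
  shows Lp_norm_distr: "Lp_norm p (distr M N' T) f = Lp_norm p M (\<lambda>x. f (T x))"
    and Lp_funs_distr: "f \<in> Lp_funs p (distr M N' T) \<longleftrightarrow> (\<lambda>x. f (T x)) \<in> Lp_funs p M"
proof -
  have [measurable]: "T \<in> M \<rightarrow>\<^sub>M N'" "f \<in> borel_measurable N'"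
    using assms by (auto cong: measurable_cong_sets)
  show "Lp_norm p (distr M N' T) f = Lp_norm p M (\<lambda>x. f (T x))"
    by (simp add: Lp_norm_def integral_distr)
  show "f \<in> Lp_funs p (distr M N' T) \<longleftrightarrow> (\<lambda>x. f (T x)) \<in> Lp_funs p M"
    by (auto simp: Lp_funs_def integrable_distr_eq)
qed

lemma Lp_funs_scale:
  assumes "f \<in> Lp_funs p M"
  shows "(\<lambda>x. c * f x) \<in> Lp_funs p M"
  using assms by (auto simp: Lp_funs_def abs_mult powr_mult)

lemma Lp_norm_scale:
  assumes "1 \<le> p"
  shows "Lp_norm p M (\<lambda>x. c * f x) = \<bar>c\<bar> * Lp_norm p M f"
proof -
  have "(LINT x|M. \<bar>c * f x\<bar> powr p) = \<bar>c\<bar> powr p * (LINT x|M. \<bar>f x\<bar> powr p)"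
    by (simp add: abs_mult powr_mult)
  then show ?thesis
    using assms by (simp add: Lp_norm_def powr_mult powr_powr)
qed

lemma Lp_funs_add:
  assumes "f \<in> Lp_funs p M" "g \<in> Lp_funs p M" "1 \<le> p"
  shows "(\<lambda>x. f x + g x) \<in> Lp_funs p M"
proof -
  have [measurable]: "f \<in> borel_measurable M" "g \<in> borel_measurable M"
    using assms Lp_funs_measurable by auto
  have "integrable M (\<lambda>x. 2 powr (p - 1) * (\<bar>f x\<bar> powr p + \<bar>g x\<bar> powr p))"
    using Lp_funs_integrable[OF assms(1)] Lp_funs_integrable[OF assms(2)] by simp
  then have "integrable M (\<lambda>x. \<bar>f x + g x\<bar> powr p)"
  proof (rule Bochner_Integration.integrable_bound)
    have "\<bar>f x + g x\<bar> powr p \<le> 2 powr (p - 1) * (\<bar>f x\<bar> powr p + \<bar>g x\<bar> powr p)" for x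
    proof -
      have "\<bar>f x + g x\<bar> powr p \<le> (\<bar>f x\<bar> + \<bar>g x\<bar>) powr p"
        using assms by (intro powr_mono2) auto
      also have "\<dots> \<le> 2 powr (p - 1) * (\<bar>f x\<bar> powr p + \<bar>g x\<bar> powr p)"
        using weighted_powr_add_le[OF \<open>1 \<le> p\<close>, of "\<bar>f x\<bar>" "\<bar>g x\<bar>" 1 1] by simp
      finally show ?thesis .
    qed
    then show "AE x in M. norm (\<bar>f x + g x\<bar> powr p) \<le> norm (2 powr (p - 1) * (\<bar>f x\<bar> powr p + \<bar>g x\<bar> powr p))"
      by (auto intro: order_trans)
  qed auto
  then show ?thesis by (simp add: Lp_funs_def)
qed

lemma Lp_funs_diff:
  assumes "f \<in> Lp_funs p M" "g \<in> Lp_funs p M" "1 \<le> p"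
  shows "(\<lambda>x. f x - g x) \<in> Lp_funs p M"
  using Lp_funs_add[OF assms(1) Lp_funs_scale[OF assms(2), of "-1"] assms(3)] by simp

lemma Lp_norm_triangle:
  assumes "f \<in> Lp_funs p M" "g \<in> Lp_funs p M" "1 \<le> p"
  shows "Lp_norm p M (\<lambda>x. f x + g x) \<le> Lp_norm p M f + Lp_norm p M g"
proof (rule field_le_epsilon)
  fix e :: real assume "0 < e"
  \<comment> \<open>The extra e/2 keeps both numbers positive, so vanishing norms need no separate
    case.\<close>
  define A B where "A = Lp_norm p M f + e / 2" and "B = Lp_norm p M g + e / 2"
  have AB: "0 < A" "0 < B"
    using \<open>0 < e\<close> Lp_norm_nonneg[of p M f] Lp_norm_nonneg[of p M g] by (auto simp: A_def B_def)
  have pow: "x powr p = x * x powr (p - 1)" if "0 < x" for x :: real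
    using that by (simp add: powr_diff)
  have f: "(LINT x|M. \<bar>f x\<bar> powr p) \<le> A * A powr (p - 1)"
    using Lp_norm_le_iff[OF \<open>1 \<le> p\<close>, of A M f] AB \<open>0 < e\<close> pow[of A] by (simp add: A_def)
  have g: "(LINT x|M. \<bar>g x\<bar> powr p) \<le> B * B powr (p - 1)"
    using Lp_norm_le_iff[OF \<open>1 \<le> p\<close>, of B M g] AB \<open>0 < e\<close> pow[of B] by (simp add: B_def)
  have int: "integrable M (\<lambda>x. \<bar>f x\<bar> powr p)" "integrable M (\<lambda>x. \<bar>g x\<bar> powr p)"
    using assms Lp_funs_integrable by auto
  have "(LINT x|M. \<bar>f x + g x\<bar> powr p)
      \<le> (LINT x|M. (A + B) powr (p - 1) * (\<bar>f x\<bar> powr p / A powr (p - 1) + \<bar>g x\<bar> powr p / B powr (p - 1)))"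
  proof (rule integral_mono)
    show "\<bar>f x + g x\<bar> powr p \<le> (A + B) powr (p - 1) * (\<bar>f x\<bar> powr p / A powr (p - 1) + \<bar>g x\<bar> powr p / B powr (p - 1))" for x
    proof -
      have "\<bar>f x + g x\<bar> powr p \<le> (\<bar>f x\<bar> + \<bar>g x\<bar>) powr p"
        using assms by (intro powr_mono2) auto
      also note weighted_powr_add_le[OF \<open>1 \<le> p\<close> abs_ge_zero abs_ge_zero AB]
      finally show ?thesis .
    qed
  qed (use int Lp_funs_integrable[OF Lp_funs_add[OF assms]] in auto)
  also have "\<dots> = (A + B) powr (p - 1) * ((LINT x|M. \<bar>f x\<bar> powr p) / A powr (p - 1) + (LINT x|M. \<bar>g x\<bar> powr p) / B powr (p - 1))"
    using int by simp
  also have "\<dots> \<le> (A + B) powr (p - 1) * (A + B)"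
    using f g AB by (intro mult_left_mono add_mono) (auto simp: pos_divide_le_eq)
  also have "\<dots> = (A + B) powr p"
    using AB pow[of "A + B"] by simp
  finally show "Lp_norm p M (\<lambda>x. f x + g x) \<le> Lp_norm p M f + Lp_norm p M g + e"
    using Lp_norm_le_iff[OF \<open>1 \<le> p\<close>, of "A + B" M "\<lambda>x. f x + g x"] AB by (simp add: A_def B_def)
qed

lemma Lp_norm_triangle_diff:
  assumes "f \<in> Lp_funs p M" "g \<in> Lp_funs p M" "1 \<le> p"
  shows "Lp_norm p M f \<le> Lp_norm p M g + Lp_norm p M (\<lambda>x. f x - g x)"
  using Lp_norm_triangle[OF assms(2) Lp_funs_diff[OF assms] assms(3)] by simp

lemma Lp_norm_diff_triangle:
  assumes "f \<in> Lp_funs p M" "g \<in> Lp_funs p M" "h \<in> Lp_funs p M" "1 \<le> p"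
  shows "Lp_norm p M (\<lambda>x. f x - h x) \<le> Lp_norm p M (\<lambda>x. f x - g x) + Lp_norm p M (\<lambda>x. g x - h x)"
  using Lp_norm_triangle[OF Lp_funs_diff Lp_funs_diff, of f p M g g h] assms by simp

lemma Lp_norm_minus_commute: "Lp_norm p M (\<lambda>x. f x - g x) = Lp_norm p M (\<lambda>x. g x - f x)"
  by (rule Lp_norm_cong) (simp add: abs_minus_commute)

lemma Lp_norm_eq_0_iff:
  assumes "f \<in> Lp_funs p M" "1 \<le> p"
  shows "Lp_norm p M f = 0 \<longleftrightarrow> (AE x in M. f x = 0)"
proof -
  have "Lp_norm p M f = 0 \<longleftrightarrow> (AE x in M. \<bar>f x\<bar> powr p = 0)"
    using Lp_funs_integrable[OF assms(1)] by (simp add: Lp_norm_def integral_nonneg_eq_0_iff_AE)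
  then show ?thesis by simp
qed

lemma Lp_funs_bounded:
  assumes "finite_measure M" "f \<in> borel_measurable M" "\<And>x. x \<in> space M \<Longrightarrow> \<bar>f x\<bar> \<le> B" "1 \<le> p"
  shows "f \<in> Lp_funs p M"
proof -
  interpret finite_measure M by fact
  have "integrable M (\<lambda>x. \<bar>f x\<bar> powr p)"
    using assms by (intro integrable_const_bound[where B = "B powr p"]) (auto intro!: AE_I2 powr_mono2)
  then show ?thesis using assms by (simp add: Lp_funs_def)
qed

lemma Lp_norm_const:
  assumes "prob_space M" "1 \<le> p" "0 \<le> c"
  shows "Lp_norm p M (\<lambda>_. c) = c"
proof -
  interpret prob_space M by fact
  show ?thesis using assms by (simp add: Lp_norm_def powr_powr prob_space)
qed

section \<open>Limits and completeness in L^p\<close>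

lemma Lp_norm_dominated_convergence:
  assumes g: "g \<in> Lp_funs p M" and f: "\<And>n. f n \<in> borel_measurable M" "f' \<in> borel_measurable M"
    and lim: "AE x in M. (\<lambda>n. f n x) \<longlonglongrightarrow> f' x"
    and bound: "\<And>n. AE x in M. \<bar>f n x - f' x\<bar> \<le> \<bar>g x\<bar>" and p: "1 \<le> p"
  shows "(\<lambda>n. Lp_norm p M (\<lambda>x. f n x - f' x)) \<longlonglongrightarrow> 0"
proof -
  have [measurable]: "f n \<in> borel_measurable M" for n by fact
  note [measurable] = f(2) Lp_funs_measurable[OF g]
  have "(\<lambda>n. LINT x|M. \<bar>f n x - f' x\<bar> powr p) \<longlonglongrightarrow> (LINT x|M. 0)"
  proof (rule integral_dominated_convergence)
    show "AE x in M. (\<lambda>n. \<bar>f n x - f' x\<bar> powr p) \<longlonglongrightarrow> 0"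
      using lim
    proof eventually_elim
      case (elim x)
      then have "(\<lambda>n. \<bar>f n x - f' x\<bar>) \<longlonglongrightarrow> 0" by (simp add: LIM_zero tendsto_rabs_zero)
      then show ?case
        using tendsto_powr'[of "\<lambda>n. \<bar>f n x - f' x\<bar>" 0 sequentially "\<lambda>_. p" p] p by simp
    qed
    show "AE x in M. norm (\<bar>f n x - f' x\<bar> powr p) \<le> \<bar>g x\<bar> powr p" for n
      using bound[of n] by eventually_elim (use p in \<open>auto intro!: powr_mono2\<close>)
  qed (use Lp_funs_integrable[OF g] in auto)
  then have "(\<lambda>n. LINT x|M. \<bar>f n x - f' x\<bar> powr p) \<longlonglongrightarrow> 0" by simp
  then show ?thesis
    unfolding Lp_norm_def
    using tendsto_powr'[of "\<lambda>n. LINT x|M. \<bar>f n x - f' x\<bar> powr p" 0 sequentially "\<lambda>_. 1 / p" "1 / p"] p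
    by simp
qed

text \<open>Riesz-Fischer: a subsequence whose increments decay geometrically in norm converges
  almost everywhere, and Fatou's lemma along it shows that the whole Cauchy sequence tends to the
  pointwise limit in norm.\<close>

lemma Lp_complete:
  assumes s: "\<And>n. s n \<in> Lp_funs p M" and p: "1 \<le> p"
    and cauchy: "\<And>e. 0 < e \<Longrightarrow> \<exists>N. \<forall>m\<ge>N. \<forall>n\<ge>N. Lp_norm p M (\<lambda>x. s m x - s n x) < e"
  shows "\<exists>l\<in>Lp_funs p M. (\<lambda>n. Lp_norm p M (\<lambda>x. s n x - l x)) \<longlonglongrightarrow> 0"
proof -
  have [measurable]: "s n \<in> borel_measurable M" for n
    using s by (rule Lp_funs_measurable)
  have "\<exists>N. \<forall>m\<ge>N. \<forall>n\<ge>N. Lp_norm p M (\<lambda>x. s m x - s n x) < (1 / 4) ^ i" for i :: nat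
    by (rule cauchy) simp
  then obtain N where N: "\<And>i m n. N i \<le> m \<Longrightarrow> N i \<le> n \<Longrightarrow> Lp_norm p M (\<lambda>x. s m x - s n x) < (1 / 4) ^ i"
    by metis
  \<comment> \<open>Adding all earlier thresholds makes the indices monotone; the summand j makes
    them pass every bound, which the Fatou step needs.\<close>
  define k where "k j = j + (\<Sum>i\<le>j. N i)" for j
  have k: "N j \<le> k j" "k j \<le> k (Suc j)" "j \<le> k j" for j
    by (auto simp: k_def intro: trans_le_add2 member_le_sum)
  define a where "a j x = s (k (Suc j)) x - s (k j) x" for j x
  have a: "a j \<in> Lp_funs p M" "Lp_norm p M (a j) \<le> (1 / 4) ^ j" for j
    using N[of j "k (Suc j)" "k j"] k[of j] Lp_funs_diff[OF s s p]
    unfolding a_def by auto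
  have [measurable]: "a j \<in> borel_measurable M" for j
    using a(1) by (rule Lp_funs_measurable)
  \<comment> \<open>Weighting the increments by powers of two turns the finiteness of the sum below into
    geometric decay of the increments almost everywhere.\<close>
  have int: "(LINT x|M. \<bar>2 ^ j * a j x\<bar> powr p) \<le> (1 / 2) ^ j" for j :: nat
  proof -
    have "Lp_norm p M (\<lambda>x. 2 ^ j * a j x) \<le> 2 ^ j * (1 / 4) ^ j"
      using a(2)[of j] by (simp add: Lp_norm_scale p)
    also have "\<dots> = (1 / 2) ^ j"
      by (simp flip: power_mult_distrib)
    finally have "(LINT x|M. \<bar>2 ^ j * a j x\<bar> powr p) \<le> ((1 / 2) ^ j) powr p"
      by (subst (asm) Lp_norm_le_iff) (use p in auto)
    also have "\<dots> \<le> ((1 / 2) ^ j) powr 1"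
      using p by (intro powr_mono') (auto simp: power_le_one)
    finally show ?thesis by simp
  qed
  have "(\<integral>\<^sup>+x. (\<Sum>j. ennreal (\<bar>2 ^ j * a j x\<bar> powr p)) \<partial>M) = (\<Sum>j. \<integral>\<^sup>+x. ennreal (\<bar>2 ^ j * a j x\<bar> powr p) \<partial>M)"
    by (rule nn_integral_suminf) measurable
  also have "\<dots> = (\<Sum>j. ennreal (LINT x|M. \<bar>2 ^ j * a j x\<bar> powr p))"
    by (intro suminf_cong nn_integral_eq_integral Lp_funs_integrable[OF Lp_funs_scale[OF a(1)]]) auto
  also have "\<dots> \<le> (\<Sum>j. ennreal ((1 / 2) ^ j))"
    using int by (intro suminf_le ennreal_leI) auto
  also have "\<dots> = ennreal (\<Sum>j. (1 / 2) ^ j)"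
    by (rule suminf_ennreal2) auto
  also have "\<dots> < \<infinity>" by simp
  finally have "(\<integral>\<^sup>+x. (\<Sum>j. ennreal (\<bar>2 ^ j * a j x\<bar> powr p)) \<partial>M) \<noteq> \<infinity>"
    by simp
  then have "AE x in M. (\<Sum>j. ennreal (\<bar>2 ^ j * a j x\<bar> powr p)) \<noteq> \<infinity>"
    by (intro nn_integral_noteq_infinite) measurable
  then have conv: "AE x in M. convergent (\<lambda>i. s (k i) x)"
  proof eventually_elim
    case (elim x)
    then have "summable (\<lambda>j. \<bar>2 ^ j * a j x\<bar> powr p)"
      by (intro summable_suminf_not_top) auto
    then have "(\<lambda>j. \<bar>2 ^ j * a j x\<bar> powr p) \<longlonglongrightarrow> 0" by (rule summable_LIMSEQ_zero)
    then have "eventually (\<lambda>j. \<bar>2 ^ j * a j x\<bar> powr p < 1) sequentially"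
      by (rule order_tendstoD) simp
    then have "eventually (\<lambda>j. norm (a j x) \<le> (1 / 2) ^ j) sequentially"
    proof eventually_elim
      case (elim j)
      then have "\<bar>2 ^ j * a j x\<bar> \<le> 1"
        using ge_one_powr_ge_zero[of "\<bar>2 ^ j * a j x\<bar>" p] p by linarith
      then show ?case by (simp add: abs_mult field_simps)
    qed
    then have "summable (\<lambda>j. a j x)"
      by (rule summable_comparison_test_ev) simp
    then have "convergent (\<lambda>i. s (k 0) x + (\<Sum>j<i. a j x))"
      by (intro convergent_add convergent_const) (simp add: summable_iff_convergent)
    then show ?case
      by (simp add: a_def sum_lessThan_telescope[of "\<lambda>i. s (k i) x"])
  qed
  \<comment> \<open>\<open>lim\<close> is total, so l is defined and measurable everywhere; its
    values matter only on the set of convergence, which has full measure.\<close>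
  define l where "l x = lim (\<lambda>i. s (k i) x)" for x
  have [measurable]: "l \<in> borel_measurable M"
    unfolding l_def by measurable
  \<comment> \<open>Fatou gives integrability of the difference and the bound on its norm at
    once.\<close>
  have diff: "(\<lambda>x. s n x - l x) \<in> Lp_funs p M \<and> Lp_norm p M (\<lambda>x. s n x - l x) \<le> e"
    if "0 < e" "\<And>m. N' \<le> m \<Longrightarrow> Lp_norm p M (\<lambda>x. s n x - s m x) < e" for e n N'
  proof -
    have "(\<integral>\<^sup>+x. ennreal (\<bar>s n x - l x\<bar> powr p) \<partial>M)
        = (\<integral>\<^sup>+x. liminf (\<lambda>i. ennreal (\<bar>s n x - s (k i) x\<bar> powr p)) \<partial>M)"
    proof (rule nn_integral_cong_AE)
      show "AE x in M. ennreal (\<bar>s n x - l x\<bar> powr p) = liminf (\<lambda>i. ennreal (\<bar>s n x - s (k i) x\<bar> powr p))"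
        using conv
      proof eventually_elim
        case (elim x)
        then have "(\<lambda>i. s (k i) x) \<longlonglongrightarrow> l x" by (simp add: l_def convergent_LIMSEQ_iff)
        then have "(\<lambda>i. \<bar>s n x - s (k i) x\<bar> powr p) \<longlonglongrightarrow> \<bar>s n x - l x\<bar> powr p"
          using p by (intro tendsto_powr' tendsto_intros) auto
        then show ?case
          by (intro lim_imp_Liminf[symmetric] tendsto_ennrealI) auto
      qed
    qed
    also have "\<dots> \<le> liminf (\<lambda>i. \<integral>\<^sup>+x. ennreal (\<bar>s n x - s (k i) x\<bar> powr p) \<partial>M)"
      by (rule nn_integral_liminf) measurable
    also have "\<dots> \<le> ennreal (e powr p)"
    proof (rule Liminf_le)
      show "\<forall>\<^sub>F i in sequentially. (\<integral>\<^sup>+x. ennreal (\<bar>s n x - s (k i) x\<bar> powr p) \<partial>M) \<le> ennreal (e powr p)"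
        using eventually_ge_at_top[of N']
      proof eventually_elim
        case (elim i)
        then have "Lp_norm p M (\<lambda>x. s n x - s (k i) x) \<le> e"
          using that(2)[of "k i"] k(3)[of i] by (simp add: less_imp_le)
        then have "(LINT x|M. \<bar>s n x - s (k i) x\<bar> powr p) \<le> e powr p"
          using p \<open>0 < e\<close> by (subst (asm) Lp_norm_le_iff) auto
        then show ?case
          by (subst nn_integral_eq_integral)
            (auto intro!: Lp_funs_integrable[OF Lp_funs_diff[OF s s p]] ennreal_leI)
      qed
    qed auto
    finally have le: "(\<integral>\<^sup>+x. ennreal (\<bar>s n x - l x\<bar> powr p) \<partial>M) \<le> ennreal (e powr p)" .
    then have int: "integrable M (\<lambda>x. \<bar>s n x - l x\<bar> powr p)"
      by (intro integrableI_nonneg) (auto simp: less_top[symmetric] top_unique)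
    have "(LINT x|M. \<bar>s n x - l x\<bar> powr p) \<le> e powr p"
      using le by (subst (asm) nn_integral_eq_integral[OF int]) auto
    then show ?thesis
      using int p \<open>0 < e\<close> by (auto simp: Lp_funs_def Lp_norm_le_iff)
  qed
  show ?thesis
  proof
    \<comment> \<open>The limit is recovered as \<open>s (N 0)\<close> minus this difference; the
      bound 1 is the threshold \<open>(1 / 4) ^ 0\<close> belonging to \<open>N 0\<close>.\<close>
    have "(\<lambda>x. s (N 0) x - l x) \<in> Lp_funs p M"
      using diff[of 1 "N 0" "N 0"] N[of 0] by simp
    from Lp_funs_diff[OF s[of "N 0"] this p] show "l \<in> Lp_funs p M" by simp
    show "(\<lambda>n. Lp_norm p M (\<lambda>x. s n x - l x)) \<longlonglongrightarrow> 0"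
    proof (rule LIMSEQ_I)
      fix e :: real assume "0 < e"
      then obtain N' where "\<And>m n. N' \<le> m \<Longrightarrow> N' \<le> n \<Longrightarrow> Lp_norm p M (\<lambda>x. s m x - s n x) < e / 2"
        using cauchy[of "e / 2"] by auto
      then have "Lp_norm p M (\<lambda>x. s n x - l x) \<le> e / 2" if "N' \<le> n" for n
        using diff[of "e / 2" N' n] \<open>0 < e\<close> that by auto
      then show "\<exists>N. \<forall>n\<ge>N. norm (Lp_norm p M (\<lambda>x. s n x - l x) - 0) < e"
        using \<open>0 < e\<close> Lp_norm_nonneg[of p M] by (intro exI[of _ N']) (force intro: le_less_trans[of _ "e / 2"])
    qed
  qed
qed


section \<open>The Banach space of equivalence classes\<close>

definition Lp_class :: "real \<Rightarrow> 'a measure \<Rightarrow> ('a \<Rightarrow> real) \<Rightarrow> ('a \<Rightarrow> real) set" where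
  "Lp_class p M u = Lp_rel p M `` {u}"

lemma equiv_Lp_rel: "equiv (Lp_funs p M) (Lp_rel p M)"
  by (intro equivI refl_onI symI transI) (auto simp: Lp_rel_def elim: AE_mp)

lemma Lp_class_eq_iff:
  assumes "u \<in> Lp_funs p M" "v \<in> Lp_funs p M"
  shows "Lp_class p M u = Lp_class p M v \<longleftrightarrow> (AE x in M. u x = v x)"
  using eq_equiv_class_iff[OF equiv_Lp_rel assms] assms by (simp add: Lp_class_def Lp_rel_def)

lemma mem_Lp_class_iff:
  "v \<in> Lp_class p M u \<longleftrightarrow> u \<in> Lp_funs p M \<and> v \<in> Lp_funs p M \<and> (AE x in M. u x = v x)"
  by (simp add: Lp_class_def Lp_rel_def)

lemma carrier_Lp: "carrier (Lp p M) = Lp_class p M ` Lp_funs p M"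
  by (auto simp: Lp_def Lp_class_def quotient_def)

lemma Lp_class_in_carrier: "u \<in> Lp_funs p M \<Longrightarrow> Lp_class p M u \<in> carrier (Lp p M)"
  by (simp add: carrier_Lp)

lemma
  assumes "U \<in> carrier (Lp p M)"
  shows Lp_rep_in_Lp_funs: "Lp_rep U \<in> Lp_funs p M"
    and Lp_class_Lp_rep: "Lp_class p M (Lp_rep U) = U"
proof -
  obtain u where u: "u \<in> Lp_funs p M" "U = Lp_class p M u"
    using assms by (auto simp: carrier_Lp)
  then have "u \<in> U" by (simp add: mem_Lp_class_iff)
  then have "Lp_rep U \<in> U" unfolding Lp_rep_def by (rule someI[of "\<lambda>u. u \<in> U"])
  then have rep: "Lp_rep U \<in> Lp_funs p M" "AE x in M. u x = Lp_rep U x"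
    using u by (auto simp: mem_Lp_class_iff)
  then show "Lp_rep U \<in> Lp_funs p M" "Lp_class p M (Lp_rep U) = U"
    using u Lp_class_eq_iff[OF u(1) rep(1)] by simp_all
qed

lemma Lp_rep_Lp_class:
  assumes "u \<in> Lp_funs p M"
  shows "AE x in M. Lp_rep (Lp_class p M u) x = u x"
  using Lp_class_Lp_rep[OF Lp_class_in_carrier[OF assms]]
    Lp_class_eq_iff[OF Lp_rep_in_Lp_funs[OF Lp_class_in_carrier[OF assms]] assms] by simp

lemma zero_Lp: "\<zero>\<^bsub>Lp p M\<^esub> = Lp_class p M (\<lambda>x. 0)"
  by (simp add: Lp_def Lp_class_def)

lemma Lp_funs_zero: "(\<lambda>x. 0) \<in> Lp_funs p M"
  by (simp add: Lp_funs_def)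

text \<open>The double union runs over all pairs of representatives. It collapses to one class
  because every pair yields the same class and at least one pair exists.\<close>

lemma add_Lp:
  assumes "u \<in> Lp_funs p M" "v \<in> Lp_funs p M" "1 \<le> p"
  shows "Lp_class p M u \<oplus>\<^bsub>Lp p M\<^esub> Lp_class p M v = Lp_class p M (\<lambda>x. u x + v x)"
proof -
  have "Lp_class p M (\<lambda>x. u' x + v' x) = Lp_class p M (\<lambda>x. u x + v x)"
    if "u' \<in> Lp_class p M u" "v' \<in> Lp_class p M v" for u' v'
    using that assms
    by (subst Lp_class_eq_iff) (auto simp: mem_Lp_class_iff intro: Lp_funs_add)
  moreover have "u \<in> Lp_class p M u" "v \<in> Lp_class p M v"
    using assms by (auto simp: mem_Lp_class_iff)
  ultimately have "(\<Union>u'\<in>Lp_class p M u. \<Union>v'\<in>Lp_class p M v. Lp_class p M (\<lambda>x. u' x + v' x))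
      = Lp_class p M (\<lambda>x. u x + v x)"
    by blast
  then show ?thesis by (simp add: Lp_def flip: Lp_class_def)
qed

lemma smult_Lp:
  assumes "u \<in> Lp_funs p M"
  shows "c \<odot>\<^bsub>Lp p M\<^esub> Lp_class p M u = Lp_class p M (\<lambda>x. c * u x)"
proof -
  have "Lp_class p M (\<lambda>x. c * u' x) = Lp_class p M (\<lambda>x. c * u x)" if "u' \<in> Lp_class p M u" for u'
  proof -
    from that have u': "u' \<in> Lp_funs p M" "AE x in M. u x = u' x"
      by (auto simp: mem_Lp_class_iff)
    from u'(2) have "AE x in M. c * u' x = c * u x" by eventually_elim simp
    then show ?thesis
      using u' assms by (subst Lp_class_eq_iff) (auto intro: Lp_funs_scale)
  qed
  moreover have "u \<in> Lp_class p M u"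
    using assms by (auto simp: mem_Lp_class_iff)
  ultimately have "(\<Union>u'\<in>Lp_class p M u. Lp_class p M (\<lambda>x. c * u' x)) = Lp_class p M (\<lambda>x. c * u x)"
    by blast
  then show ?thesis by (simp add: Lp_def flip: Lp_class_def)
qed

lemma nrm_Lp: "nrm (Lp p M) U = Lp_norm p M (Lp_rep U)"
  by (simp add: Lp_def Lp_norm_def)

lemma nrm_Lp_class:
  assumes "u \<in> Lp_funs p M"
  shows "nrm (Lp p M) (Lp_class p M u) = Lp_norm p M u"
  unfolding nrm_Lp using Lp_rep_Lp_class[OF assms]
  by (intro Lp_norm_cong_AE Lp_funs_measurable[of _ p]
      Lp_rep_in_Lp_funs[OF Lp_class_in_carrier[OF assms]] assms) auto

lemma cring_real_ring: "cring real_ring"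
proof (rule cringI)
  show "abelian_group real_ring"
    by (rule abelian_groupI) (auto simp: real_ring_def intro: exI[of _ "- x" for x :: real])
  show "comm_monoid real_ring"
    by (rule comm_monoidI) (auto simp: real_ring_def)
qed (auto simp: real_ring_def distrib_right)

lemma module_Lp:
  assumes p: "1 \<le> p"
  shows "module real_ring (Lp p M)"
proof (rule moduleI)
  show "cring real_ring" by (rule cring_real_ring)
  show "abelian_group (Lp p M)"
  proof (rule abelian_groupI)
    show "\<exists>y\<in>carrier (Lp p M). y \<oplus>\<^bsub>Lp p M\<^esub> x = \<zero>\<^bsub>Lp p M\<^esub>" if "x \<in> carrier (Lp p M)" for x
    proof -
      from that obtain u where u: "u \<in> Lp_funs p M" "x = Lp_class p M u"
        by (auto simp: carrier_Lp)
      then show ?thesis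
        using Lp_funs_scale[OF u(1), of "-1"]
        by (intro bexI[of _ "Lp_class p M (\<lambda>x. - 1 * u x)"])
          (simp_all only: add_Lp[OF _ _ p] zero_Lp Lp_class_in_carrier, simp_all)
    qed
  qed (auto simp: carrier_Lp add_Lp[OF _ _ p] zero_Lp Lp_funs_add[OF _ _ p] Lp_funs_zero add_ac)
qed (auto simp: real_ring_def carrier_Lp add_Lp[OF _ _ p] smult_Lp Lp_funs_add[OF _ _ p] Lp_funs_scale
    distrib_left distrib_right mult.assoc)

lemma minus_Lp:
  assumes "u \<in> Lp_funs p M" "v \<in> Lp_funs p M" "1 \<le> p"
  shows "Lp_class p M u \<ominus>\<^bsub>Lp p M\<^esub> Lp_class p M v = Lp_class p M (\<lambda>x. u x - v x)"
proof -
  interpret module real_ring "Lp p M" using assms by (intro module_Lp)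
  have v: "(\<lambda>x. - v x) \<in> Lp_funs p M"
    using Lp_funs_scale[OF assms(2), of "-1"] by simp
  have "\<ominus>\<^bsub>Lp p M\<^esub> Lp_class p M v = Lp_class p M (\<lambda>x. - v x)"
    using assms v by (intro M.minus_equality) (simp_all add: add_Lp zero_Lp Lp_class_in_carrier)
  then show ?thesis
    using assms v by (simp add: a_minus_def add_Lp)
qed

lemma banach_space_Lp:
  assumes p: "1 \<le> p"
  shows "banach_space (Lp p M)"
proof -
  interpret module real_ring "Lp p M" using p by (rule module_Lp)
  show ?thesis
  proof
    fix x y c
    assume "x \<in> carrier (Lp p M)"
    then obtain u where u: "u \<in> Lp_funs p M" "x = Lp_class p M u"
      by (auto simp: carrier_Lp)
    show "nrm (Lp p M) x = 0 \<longleftrightarrow> x = \<zero>\<^bsub>Lp p M\<^esub>"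
      using u p by (simp add: nrm_Lp_class zero_Lp Lp_class_eq_iff Lp_funs_zero Lp_norm_eq_0_iff)
    show "0 \<le> nrm (Lp p M) x"
      by (simp add: nrm_Lp Lp_norm_nonneg)
    show "nrm (Lp p M) (c \<odot>\<^bsub>Lp p M\<^esub> x) = \<bar>c\<bar> * nrm (Lp p M) x"
      using u p by (simp add: smult_Lp nrm_Lp_class Lp_funs_scale Lp_norm_scale)
    assume "y \<in> carrier (Lp p M)"
    then obtain v where v: "v \<in> Lp_funs p M" "y = Lp_class p M v"
      by (auto simp: carrier_Lp)
    show "nrm (Lp p M) (x \<oplus>\<^bsub>Lp p M\<^esub> y) \<le> nrm (Lp p M) x + nrm (Lp p M) y"
      using u v p by (simp add: add_Lp nrm_Lp_class Lp_funs_add Lp_norm_triangle)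
  next
    fix s :: "nat \<Rightarrow> ('a \<Rightarrow> real) set"
    assume s: "\<And>n. s n \<in> carrier (Lp p M)"
      and cauchy: "\<And>e. 0 < e \<Longrightarrow> \<exists>N. \<forall>m\<ge>N. \<forall>n\<ge>N. nrm (Lp p M) (s m \<ominus>\<^bsub>Lp p M\<^esub> s n) < e"
    define t where "t n = Lp_rep (s n)" for n
    have t: "t n \<in> Lp_funs p M" "s n = Lp_class p M (t n)" for n
      using Lp_rep_in_Lp_funs[OF s] Lp_class_Lp_rep[OF s] by (auto simp: t_def)
    have diff: "nrm (Lp p M) (s n \<ominus>\<^bsub>Lp p M\<^esub> Lp_class p M u) = Lp_norm p M (\<lambda>x. t n x - u x)"
      if "u \<in> Lp_funs p M" for n u
      using t that p by (simp add: minus_Lp nrm_Lp_class Lp_funs_diff)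
    obtain l where "l \<in> Lp_funs p M" "(\<lambda>n. Lp_norm p M (\<lambda>x. t n x - l x)) \<longlonglongrightarrow> 0"
      using Lp_complete[of t p M] t(1) p cauchy by (auto simp: diff[OF t(1)] t(2)[symmetric] simp flip: diff)
    then show "\<exists>x\<in>carrier (Lp p M). (\<lambda>n. nrm (Lp p M) (s n \<ominus>\<^bsub>Lp p M\<^esub> x)) \<longlonglongrightarrow> 0"
      by (intro bexI[of _ "Lp_class p M l"]) (simp_all add: diff Lp_class_in_carrier)
  qed
qed

section \<open>Couplings\<close>

lemma
  assumes "\<pi> \<in> couplings \<mu> \<nu>"
  shows couplings_prob_space: "prob_space \<pi>"
    and couplings_distr_fst: "distr \<pi> \<mu> fst = \<mu>"
    and couplings_distr_snd: "distr \<pi> \<nu> snd = \<nu>"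
    and couplings_space: "space \<pi> = space \<mu> \<times> space \<nu>"
    and couplings_measurable_fst: "fst \<in> \<pi> \<rightarrow>\<^sub>M \<mu>"
    and couplings_measurable_snd: "snd \<in> \<pi> \<rightarrow>\<^sub>M \<nu>"
proof -
  show "prob_space \<pi>" "distr \<pi> \<mu> fst = \<mu>" "distr \<pi> \<nu> snd = \<nu>"
    using assms by (auto simp: couplings_def)
  have sets: "sets \<pi> = sets (\<mu> \<Otimes>\<^sub>M \<nu>)"
    using assms by (simp add: couplings_def)
  show "space \<pi> = space \<mu> \<times> space \<nu>"
    using sets_eq_imp_space_eq[OF sets] by (simp add: space_pair_measure)
  show "fst \<in> \<pi> \<rightarrow>\<^sub>M \<mu>" "snd \<in> \<pi> \<rightarrow>\<^sub>M \<nu>"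
    by (simp_all add: measurable_cong_sets[OF sets refl])
qed

lemma
  assumes "\<pi> \<in> couplings \<mu> \<nu>" "f \<in> borel_measurable \<mu>"
  shows Lp_norm_coupling_fst: "Lp_norm p \<pi> (\<lambda>z. f (fst z)) = Lp_norm p \<mu> f"
    and Lp_funs_coupling_fst: "(\<lambda>z. f (fst z)) \<in> Lp_funs p \<pi> \<longleftrightarrow> f \<in> Lp_funs p \<mu>"
  using Lp_norm_distr[OF couplings_measurable_fst assms(2) refl] Lp_funs_distr[OF couplings_measurable_fst assms(2) refl]
    couplings_distr_fst assms by metis+

lemma
  assumes "\<pi> \<in> couplings \<mu> \<nu>" "f \<in> borel_measurable \<nu>"
  shows Lp_norm_coupling_snd: "Lp_norm p \<pi> (\<lambda>z. f (snd z)) = Lp_norm p \<nu> f"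
    and Lp_funs_coupling_snd: "(\<lambda>z. f (snd z)) \<in> Lp_funs p \<pi> \<longleftrightarrow> f \<in> Lp_funs p \<nu>"
  using Lp_norm_distr[OF couplings_measurable_snd assms(2) refl] Lp_funs_distr[OF couplings_measurable_snd assms(2) refl]
    couplings_distr_snd assms by metis+

text \<open>The coupling has density \<open>1 / P {c = k}\<close> on each block \<open>{c = k} \<times> {c' = k}\<close>.\<close>

lemma coupling_of_cells:
  fixes c :: "'a \<Rightarrow> nat" and c' :: "'b \<Rightarrow> nat"
  assumes P: "prob_space P" and Q: "prob_space Q"
    and [measurable]: "c \<in> P \<rightarrow>\<^sub>M count_space UNIV" "c' \<in> Q \<rightarrow>\<^sub>M count_space UNIV"
    and eq: "\<And>k. emeasure P {x \<in> space P. c x = k} = emeasure Q {y \<in> space Q. c' y = k}"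
  shows "\<exists>\<gamma>\<in>couplings P Q. AE z in \<gamma>. c (fst z) = c' (snd z)"
proof -
  interpret P: prob_space P by fact
  interpret Q: prob_space Q by fact
  interpret PQ: pair_prob_space P Q ..
  define w where "w k = emeasure P {x \<in> space P. c x = k}" for k
  have w_Q: "emeasure Q {y \<in> space Q. c' y = k} = w k" for k
    by (simp add: w_def eq)
  have w_finite: "w k \<noteq> \<top>" for k
    by (simp add: w_def)
  \<comment> \<open>On a cell of mass 0 the extended quotient is infinite. Such cells are null for
    both measures, so the marginals do not see them.\<close>
  define f where "f z = (if c (fst z) = c' (snd z) then 1 / w (c (fst z)) else 0)" for z
  have [measurable]: "(\<lambda>x. 1 / w (c x)) \<in> borel_measurable P"
    by (rule measurable_compose[of c P "count_space UNIV" "\<lambda>k. 1 / w k"]) simp_all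
  \<comment> \<open>The diagonal condition is a countable union over the common value k.\<close>
  have [measurable]: "Measurable.pred (P \<Otimes>\<^sub>M Q) (\<lambda>z. c (fst z) = c' (snd z))"
  proof -
    have "Measurable.pred (P \<Otimes>\<^sub>M Q) (\<lambda>z. \<exists>k. c (fst z) = k \<and> c' (snd z) = k)" by measurable
    then show ?thesis by (simp add: eq_commute)
  qed
  have [measurable]: "f \<in> borel_measurable (P \<Otimes>\<^sub>M Q)"
    unfolding f_def by measurable
  define \<gamma> where "\<gamma> = density (P \<Otimes>\<^sub>M Q) f"
  have [measurable_cong]: "sets \<gamma> = sets (P \<Otimes>\<^sub>M Q)"
    by (simp add: \<gamma>_def)
  have nonnull_P: "AE x in P. w (c x) \<noteq> 0"
  proof -
    have "AE x in P. w k = 0 \<longrightarrow> c x \<noteq> k" for k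
      by (cases "w k = 0") (auto intro!: AE_I[of _ _ "{x \<in> space P. c x = k}"] simp: w_def)
    then have "AE x in P. \<forall>k. w k = 0 \<longrightarrow> c x \<noteq> k" by (simp add: AE_all_countable)
    then show ?thesis by eventually_elim auto
  qed
  have nonnull_Q: "AE y in Q. w (c' y) \<noteq> 0"
  proof -
    have "AE y in Q. w k = 0 \<longrightarrow> c' y \<noteq> k" for k
      by (cases "w k = 0") (auto intro!: AE_I[of _ _ "{y \<in> space Q. c' y = k}"] simp: w_Q)
    then have "AE y in Q. \<forall>k. w k = 0 \<longrightarrow> c' y \<noteq> k" by (simp add: AE_all_countable)
    then show ?thesis by eventually_elim auto
  qed
  \<comment> \<open>For fixed x the density is constant on one cell of Q and equals the reciprocal
    of that cell's mass. By Fubini this yields the first marginal, and symmetrically the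
    second.\<close>
  have slice_P: "(\<integral>\<^sup>+y. f (x, y) \<partial>Q) = 1" if "w (c x) \<noteq> 0" for x
  proof -
    have "(\<integral>\<^sup>+y. f (x, y) \<partial>Q) = (\<integral>\<^sup>+y. 1 / w (c x) * indicator {y \<in> space Q. c' y = c x} y \<partial>Q)"
      by (intro nn_integral_cong) (auto simp: f_def indicator_def)
    also have "\<dots> = 1 / w (c x) * w (c x)"
      by (subst nn_integral_cmult_indicator) (auto simp: w_Q)
    also have "\<dots> = 1"
      using that w_finite[of "c x"] by (simp add: ennreal_divide_times less_top)
    finally show ?thesis .
  qed
  have slice_Q: "(\<integral>\<^sup>+x. f (x, y) \<partial>P) = 1" if "w (c' y) \<noteq> 0" for y
  proof -
    have "(\<integral>\<^sup>+x. f (x, y) \<partial>P) = (\<integral>\<^sup>+x. 1 / w (c' y) * indicator {x \<in> space P. c x = c' y} x \<partial>P)"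
      by (intro nn_integral_cong) (auto simp: f_def indicator_def)
    also have "\<dots> = 1 / w (c' y) * w (c' y)"
      by (subst nn_integral_cmult_indicator) (auto simp: w_def)
    also have "\<dots> = 1"
      using that w_finite[of "c' y"] by (simp add: ennreal_divide_times less_top)
    finally show ?thesis .
  qed
  have fst: "distr \<gamma> P fst = P"
  proof (rule measure_eqI)
    fix A assume "A \<in> sets (distr \<gamma> P fst)"
    then have [measurable]: "A \<in> sets P" by simp
    have "emeasure (distr \<gamma> P fst) A = (\<integral>\<^sup>+z. f z * indicator (fst -` A \<inter> space (P \<Otimes>\<^sub>M Q)) z \<partial>(P \<Otimes>\<^sub>M Q))"
      by (subst emeasure_distr) (auto simp: \<gamma>_def emeasure_density)
    also have "\<dots> = (\<integral>\<^sup>+z. f z * indicator A (fst z) \<partial>(P \<Otimes>\<^sub>M Q))"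
      by (intro nn_integral_cong) (auto simp: indicator_def)
    also have "\<dots> = (\<integral>\<^sup>+x. (\<integral>\<^sup>+y. f (x, y) * indicator A x \<partial>Q) \<partial>P)"
      by (subst Q.nn_integral_fst[symmetric]) auto
    also have "\<dots> = (\<integral>\<^sup>+x. (\<integral>\<^sup>+y. f (x, y) \<partial>Q) * indicator A x \<partial>P)"
      by (intro nn_integral_cong nn_integral_multc) measurable
    also have "\<dots> = (\<integral>\<^sup>+x. indicator A x \<partial>P)"
      using nonnull_P by (intro nn_integral_cong_AE, eventually_elim) (simp add: slice_P)
    finally show "emeasure (distr \<gamma> P fst) A = emeasure P A" by simp
  qed simp
  have snd: "distr \<gamma> Q snd = Q"
  proof (rule measure_eqI)
    fix A assume "A \<in> sets (distr \<gamma> Q snd)"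
    then have [measurable]: "A \<in> sets Q" by simp
    have "emeasure (distr \<gamma> Q snd) A = (\<integral>\<^sup>+z. f z * indicator (snd -` A \<inter> space (P \<Otimes>\<^sub>M Q)) z \<partial>(P \<Otimes>\<^sub>M Q))"
      by (subst emeasure_distr) (auto simp: \<gamma>_def emeasure_density)
    also have "\<dots> = (\<integral>\<^sup>+z. f z * indicator A (snd z) \<partial>(P \<Otimes>\<^sub>M Q))"
      by (intro nn_integral_cong) (auto simp: indicator_def)
    also have "\<dots> = (\<integral>\<^sup>+y. (\<integral>\<^sup>+x. f (x, y) * indicator A y \<partial>P) \<partial>Q)"
      by (subst PQ.nn_integral_snd[symmetric]) auto
    also have "\<dots> = (\<integral>\<^sup>+y. (\<integral>\<^sup>+x. f (x, y) \<partial>P) * indicator A y \<partial>Q)"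
      by (intro nn_integral_cong nn_integral_multc) measurable
    also have "\<dots> = (\<integral>\<^sup>+y. indicator A y \<partial>Q)"
      using nonnull_Q by (intro nn_integral_cong_AE, eventually_elim) (simp add: slice_Q)
    finally show "emeasure (distr \<gamma> Q snd) A = emeasure Q A" by simp
  qed simp
  \<comment> \<open>Total mass can be read off from a marginal.\<close>
  have "prob_space (distr \<gamma> P fst)" by (simp add: fst P)
  then have "prob_space \<gamma>" by (rule prob_space_distrD[rotated]) measurable
  with fst snd have "\<gamma> \<in> couplings P Q"
    by (simp add: couplings_def \<gamma>_def)
  moreover have "AE z in \<gamma>. c (fst z) = c' (snd z)"
    unfolding \<gamma>_def by (subst AE_density) (auto simp: f_def)
  ultimately show ?thesis by blast
qed

text \<open>With a single cell the density is 1 and the construction gives the product measure.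
  Nonemptiness makes the infimum over plans meaningful.\<close>

lemma couplings_nonempty:
  assumes "prob_space P" "prob_space Q"
  shows "couplings P Q \<noteq> {}"
proof -
  have eq: "emeasure P {x \<in> space P. 0 = k} = emeasure Q {x \<in> space Q. 0 = k}" for k :: nat
    using assms by (cases "k = 0") (simp_all add: prob_space.emeasure_space_1)
  have "\<exists>\<gamma>\<in>couplings P Q. AE z in \<gamma>. (0::nat) = 0"
    using assms eq by (intro coupling_of_cells) auto
  then show ?thesis by auto
qed

text \<open>Only the two outer marginals matter here: the two middle coordinates may differ, which
  is what permits gluing up to an error.\<close>

lemma coupling_compose:
  fixes P :: "('a \<times> 'b) measure" and Q :: "('b \<times> 'c) measure"
  assumes "P \<in> couplings \<mu> \<nu>" "Q \<in> couplings \<nu> \<kappa>" "\<gamma> \<in> couplings P Q"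
  shows "distr \<gamma> (\<mu> \<Otimes>\<^sub>M \<kappa>) (\<lambda>z. (fst (fst z), snd (snd z))) \<in> couplings \<mu> \<kappa>"
proof -
  note [measurable] = couplings_measurable_fst[OF assms(1)] couplings_measurable_fst[OF assms(3)]
    couplings_measurable_snd[OF assms(2)] couplings_measurable_snd[OF assms(3)]
  have "distr (distr \<gamma> (\<mu> \<Otimes>\<^sub>M \<kappa>) (\<lambda>z. (fst (fst z), snd (snd z)))) \<mu> fst = distr (distr \<gamma> P fst) \<mu> fst"
    by (simp add: distr_distr comp_def)
  moreover have "distr (distr \<gamma> (\<mu> \<Otimes>\<^sub>M \<kappa>) (\<lambda>z. (fst (fst z), snd (snd z)))) \<kappa> snd = distr (distr \<gamma> Q snd) \<kappa> snd"
    by (simp add: distr_distr comp_def)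
  ultimately show ?thesis
    using assms
    by (auto simp: couplings_def intro!: prob_space.prob_space_distr)
qed

lemma coupling_swap:
  assumes "P \<in> couplings \<mu> \<nu>"
  shows "distr P (\<nu> \<Otimes>\<^sub>M \<mu>) (\<lambda>z. (snd z, fst z)) \<in> couplings \<nu> \<mu>"
proof -
  note [measurable] = couplings_measurable_fst[OF assms(1)] couplings_measurable_snd[OF assms(1)]
  show ?thesis
    using assms
    by (auto simp: couplings_def distr_distr comp_def intro!: prob_space.prob_space_distr)
qed

lemma coupling_diag:
  assumes "prob_space \<mu>"
  shows "distr \<mu> (\<mu> \<Otimes>\<^sub>M \<mu>) (\<lambda>x. (x, x)) \<in> couplings \<mu> \<mu>"
  using assms
  by (auto simp: couplings_def distr_distr comp_def intro!: prob_space.prob_space_distr distr_id)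


section \<open>The transport cost\<close>

text \<open>The l^p norm on the plane. Applied pointwise to the difference of values and the
  displacement, it turns the cost of a plan into the L^p norm of one real function.\<close>

definition pnorm2 :: "real \<Rightarrow> real \<Rightarrow> real \<Rightarrow> real" where
  "pnorm2 p a b = (\<bar>a\<bar> powr p + \<bar>b\<bar> powr p) powr (1 / p)"

definition tl_gauge :: "real \<Rightarrow> ('a::real_normed_vector \<Rightarrow> real) \<Rightarrow> ('a \<Rightarrow> real) \<Rightarrow> 'a \<times> 'a \<Rightarrow> real" where
  "tl_gauge p u v z = pnorm2 p (u (fst z) - v (snd z)) (norm (fst z - snd z))"

definition tl_cost ::
  "real \<Rightarrow> ('a::real_normed_vector \<Rightarrow> real) \<Rightarrow> ('a \<Rightarrow> real) \<Rightarrow> ('a \<times> 'a) measure \<Rightarrow> real" where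
  "tl_cost p u v \<pi> = Lp_norm p \<pi> (tl_gauge p u v)"

text \<open>Defined on functions instead of classes, so that representatives can be manipulated
  freely; for u = v = 0 it is the Wasserstein distance.\<close>

definition tl_inf ::
  "real \<Rightarrow> ('a::real_normed_vector \<Rightarrow> real) \<Rightarrow> 'a measure \<Rightarrow> ('a \<Rightarrow> real) \<Rightarrow> 'a measure \<Rightarrow> real" where
  "tl_inf p u \<mu> v \<nu> = (INF \<pi>\<in>couplings \<mu> \<nu>. tl_cost p u v \<pi>)"

lemma pnorm2_nonneg: "0 \<le> pnorm2 p a b"
  by (simp add: pnorm2_def)

text \<open>Counting measure on two points makes the triangle inequality in the plane an instance of
  Minkowski's inequality above.\<close>

lemma pnorm2_eq_Lp_norm: "pnorm2 p a b = Lp_norm p (count_space UNIV) (case_bool a b)"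
  by (simp add: pnorm2_def Lp_norm_def lebesgue_integral_count_space_finite UNIV_bool add.commute)

lemma pnorm2_triangle:
  assumes "1 \<le> p"
  shows "pnorm2 p (a + a') (b + b') \<le> pnorm2 p a b + pnorm2 p a' b'"
proof -
  have "case_bool (a + a') (b + b') = (\<lambda>x. case_bool a b x + case_bool a' b' x)"
    by (auto split: bool.split)
  moreover have "case_bool r s \<in> Lp_funs p (count_space UNIV)" for r s
    by (simp add: Lp_funs_def integrable_count_space)
  ultimately show ?thesis
    using assms by (simp add: pnorm2_eq_Lp_norm Lp_norm_triangle)
qed

lemma pnorm2_mono:
  assumes "1 \<le> p" "\<bar>a\<bar> \<le> \<bar>a'\<bar>" "\<bar>b\<bar> \<le> \<bar>b'\<bar>"
  shows "pnorm2 p a b \<le> pnorm2 p a' b'"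
  unfolding pnorm2_def using assms by (intro powr_mono2 add_mono) auto

lemma pnorm2_0: "1 \<le> p \<Longrightarrow> pnorm2 p a 0 = \<bar>a\<bar>" "1 \<le> p \<Longrightarrow> pnorm2 p 0 a = \<bar>a\<bar>"
  by (simp_all add: pnorm2_def powr_powr)

lemma pnorm2_le_add: "1 \<le> p \<Longrightarrow> pnorm2 p a b \<le> \<bar>a\<bar> + \<bar>b\<bar>"
  using pnorm2_triangle[of p a 0 0 b] by (simp add: pnorm2_0)

lemma pnorm2_ge: "1 \<le> p \<Longrightarrow> \<bar>a\<bar> \<le> pnorm2 p a b" "1 \<le> p \<Longrightarrow> \<bar>b\<bar> \<le> pnorm2 p a b"
  using pnorm2_mono[of p a a 0 b] pnorm2_mono[of p 0 a b b] by (simp_all add: pnorm2_0)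

lemma prob_measures_prob_space: "\<mu> \<in> prob_measures p \<Omega> \<Longrightarrow> prob_space \<mu>"
  by (simp add: prob_measures_def)

lemma prob_measures_sets: "\<mu> \<in> prob_measures p \<Omega> \<Longrightarrow> sets \<mu> = sets (restrict_space borel \<Omega>)"
  by (simp add: prob_measures_def)

lemma prob_measures_measurable:
  "\<mu> \<in> prob_measures p \<Omega> \<Longrightarrow> f \<in> borel \<rightarrow>\<^sub>M N \<Longrightarrow> f \<in> \<mu> \<rightarrow>\<^sub>M N"
  using measurable_restrict_space1 measurable_cong_sets[OF prob_measures_sets refl] by blast

lemma prob_measures_norm: "\<mu> \<in> prob_measures p \<Omega> \<Longrightarrow> norm \<in> Lp_funs p \<mu>"
  by (auto simp: Lp_funs_def prob_measures_def intro!: prob_measures_measurable[of \<mu> p \<Omega>])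

section \<open>The infimum over plans, for functions\<close>

context
  fixes p :: real and \<Omega> :: "'a::euclidean_space set"
  assumes p: "1 \<le> p"
begin

text \<open>The gauge is dominated by |u(x)| + |v(y)| + |x| + |y|. Each summand depends on one
  marginal only, and the last two are p-integrable by the finite moments.\<close>

lemma tl_gauge_in_Lp_funs:
  assumes "\<mu> \<in> prob_measures p \<Omega>" "\<nu> \<in> prob_measures p \<Omega>" "\<pi> \<in> couplings \<mu> \<nu>"
    and "u \<in> Lp_funs p \<mu>" "v \<in> Lp_funs p \<nu>"
  shows "tl_gauge p u v \<in> Lp_funs p \<pi>"
proof -
  note [measurable] = couplings_measurable_fst[OF assms(3)] couplings_measurable_snd[OF assms(3)]
    Lp_funs_measurable[OF assms(4)] Lp_funs_measurable[OF assms(5)]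
  have [measurable]: "(\<lambda>x. x) \<in> borel_measurable \<mu>" "(\<lambda>x. x) \<in> borel_measurable \<nu>"
    using assms by (auto intro: prob_measures_measurable)
  have [measurable]: "fst \<in> borel_measurable \<pi>" "snd \<in> borel_measurable \<pi>"
    by (rule measurable_compose[of fst \<pi> \<mu> "\<lambda>x. x"] measurable_compose[of snd \<pi> \<nu> "\<lambda>x. x"], measurable)+
  have meas: "tl_gauge p u v \<in> borel_measurable \<pi>"
    unfolding tl_gauge_def[abs_def] pnorm2_def by measurable
  define h where "h z = (\<bar>u (fst z)\<bar> + \<bar>v (snd z)\<bar>) + (norm (fst z) + norm (snd z))" for z
  have abs: "(\<lambda>x. \<bar>f x\<bar>) \<in> Lp_funs p M" if "f \<in> Lp_funs p M" for f and M :: "'b measure"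
    using that by (auto simp: Lp_funs_def)
  have "h \<in> Lp_funs p \<pi>"
    unfolding h_def[abs_def]
    using assms abs[OF assms(4)] abs[OF assms(5)] prob_measures_norm[of \<mu> p \<Omega>] prob_measures_norm[of \<nu> p \<Omega>]
    by (intro Lp_funs_add p iffD2[OF Lp_funs_coupling_fst[OF assms(3)]]
        iffD2[OF Lp_funs_coupling_snd[OF assms(3)]] Lp_funs_measurable[of _ p]) auto
  moreover have "\<bar>tl_gauge p u v z\<bar> \<le> \<bar>h z\<bar>" for z
  proof -
    have "\<bar>tl_gauge p u v z\<bar> \<le> \<bar>u (fst z) - v (snd z)\<bar> + \<bar>norm (fst z - snd z)\<bar>"
      using pnorm2_le_add[OF p, of "u (fst z) - v (snd z)" "norm (fst z - snd z)"]
      by (simp add: tl_gauge_def abs_of_nonneg[OF pnorm2_nonneg])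
    also have "\<dots> \<le> \<bar>h z\<bar>"
      unfolding h_def using norm_triangle_ineq4[of "fst z" "snd z"] by (auto simp: abs_if)
    finally show ?thesis .
  qed
  ultimately show ?thesis
    using Lp_funs_mono[OF _ meas AE_I2 p] by blast
qed

lemma tl_inf_le_cost: "\<pi> \<in> couplings \<mu> \<nu> \<Longrightarrow> tl_inf p u \<mu> v \<nu> \<le> tl_cost p u v \<pi>"
  unfolding tl_inf_def by (rule cINF_lower) (auto intro!: bdd_belowI2[of _ 0] simp: tl_cost_def Lp_norm_nonneg)

lemma tl_inf_greatest:
  assumes "prob_space \<mu>" "prob_space \<nu>"
    and "\<And>\<pi>. \<pi> \<in> couplings \<mu> \<nu> \<Longrightarrow> b \<le> tl_cost p u v \<pi>"
  shows "b \<le> tl_inf p u \<mu> v \<nu>"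
  unfolding tl_inf_def using assms couplings_nonempty by (intro cINF_greatest) auto

lemma tl_inf_nonneg: "prob_space \<mu> \<Longrightarrow> prob_space \<nu> \<Longrightarrow> 0 \<le> tl_inf p u \<mu> v \<nu>"
  by (rule tl_inf_greatest) (auto simp: tl_cost_def Lp_norm_nonneg)

lemma tl_inf_approx:
  assumes "prob_space \<mu>" "prob_space \<nu>" "0 < e"
  obtains \<pi> where "\<pi> \<in> couplings \<mu> \<nu>" "tl_cost p u v \<pi> < tl_inf p u \<mu> v \<nu> + e"
  using tl_inf_greatest[OF assms(1,2), of "tl_inf p u \<mu> v \<nu> + e" u v] assms(3)
  by (meson linorder_not_less less_add_same_cancel1)

lemma tl_inf_commute_le:
  assumes "\<mu> \<in> prob_measures p \<Omega>" "\<nu> \<in> prob_measures p \<Omega>" "u \<in> Lp_funs p \<mu>" "v \<in> Lp_funs p \<nu>"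
  shows "tl_inf p u \<mu> v \<nu> \<le> tl_inf p v \<nu> u \<mu>"
proof (rule tl_inf_greatest)
  fix \<pi> assume \<pi>: "\<pi> \<in> couplings \<nu> \<mu>"
  note [measurable] = couplings_measurable_fst[OF \<pi>] couplings_measurable_snd[OF \<pi>]
  let ?\<pi>' = "distr \<pi> (\<mu> \<Otimes>\<^sub>M \<nu>) (\<lambda>z. (snd z, fst z))"
  have \<pi>': "?\<pi>' \<in> couplings \<mu> \<nu>" by (rule coupling_swap[OF \<pi>])
  have [measurable]: "tl_gauge p u v \<in> borel_measurable (\<mu> \<Otimes>\<^sub>M \<nu>)"
    using Lp_funs_measurable[OF tl_gauge_in_Lp_funs[OF assms(1,2) \<pi>' assms(3,4)]] by simp
  have "tl_cost p u v ?\<pi>' = Lp_norm p \<pi> (\<lambda>z. tl_gauge p u v (snd z, fst z))"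
    unfolding tl_cost_def by (rule Lp_norm_distr) auto
  also have "\<dots> = tl_cost p v u \<pi>"
    unfolding tl_cost_def by (rule Lp_norm_cong) (simp add: tl_gauge_def pnorm2_def norm_minus_commute abs_minus_commute)
  finally show "tl_inf p u \<mu> v \<nu> \<le> tl_cost p v u \<pi>"
    using tl_inf_le_cost[OF \<pi>'] by metis
qed (use assms prob_measures_prob_space in auto)

lemma tl_inf_commute:
  assumes "\<mu> \<in> prob_measures p \<Omega>" "\<nu> \<in> prob_measures p \<Omega>" "u \<in> Lp_funs p \<mu>" "v \<in> Lp_funs p \<nu>"
  shows "tl_inf p u \<mu> v \<nu> = tl_inf p v \<nu> u \<mu>"
  using assms by (intro antisym tl_inf_commute_le)

text \<open>The diagonal plan moves no mass, so only the difference of the functions is paid. This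
  is the 1-Lipschitz property of the embeddings.\<close>

lemma tl_inf_same_le:
  assumes "\<mu> \<in> prob_measures p \<Omega>" "u \<in> Lp_funs p \<mu>" "v \<in> Lp_funs p \<mu>"
  shows "tl_inf p u \<mu> v \<mu> \<le> Lp_norm p \<mu> (\<lambda>x. u x - v x)"
proof -
  let ?\<pi> = "distr \<mu> (\<mu> \<Otimes>\<^sub>M \<mu>) (\<lambda>x. (x, x))"
  have \<pi>: "?\<pi> \<in> couplings \<mu> \<mu>"
    using assms by (intro coupling_diag prob_measures_prob_space)
  have [measurable]: "tl_gauge p u v \<in> borel_measurable (\<mu> \<Otimes>\<^sub>M \<mu>)"
    using Lp_funs_measurable[OF tl_gauge_in_Lp_funs[OF assms(1,1) \<pi> assms(2,3)]] by simp
  have "tl_cost p u v ?\<pi> = Lp_norm p \<mu> (\<lambda>x. tl_gauge p u v (x, x))"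
    unfolding tl_cost_def by (rule Lp_norm_distr) auto
  also have "\<dots> = Lp_norm p \<mu> (\<lambda>x. u x - v x)"
    by (rule Lp_norm_cong) (simp add: tl_gauge_def pnorm2_0 p)
  finally show ?thesis
    using tl_inf_le_cost[OF \<pi>] by metis
qed

lemma tl_inf_triangle:
  assumes \<mu>: "\<mu> \<in> prob_measures p \<Omega>" and \<nu>: "\<nu> \<in> prob_measures p \<Omega>" and \<kappa>: "\<kappa> \<in> prob_measures p \<Omega>"
    and u: "u \<in> Lp_funs p \<mu>" and v: "v \<in> Lp_funs p \<nu>" and w: "w \<in> Lp_funs p \<kappa>"
  shows "tl_inf p u \<mu> w \<kappa> \<le> tl_inf p u \<mu> v \<nu> + tl_inf p v \<nu> w \<kappa>"
proof (rule field_le_epsilon)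
  fix e :: real assume "0 < e"
  note prob = prob_measures_prob_space[OF \<mu>] prob_measures_prob_space[OF \<nu>] prob_measures_prob_space[OF \<kappa>]
  \<comment> \<open>One third of e pays for the choice of P, one for that of Q, and one for the
    mismatch of their middle points.\<close>
  obtain P where P: "P \<in> couplings \<mu> \<nu>" "tl_cost p u v P < tl_inf p u \<mu> v \<nu> + e / 3"
    using tl_inf_approx[OF prob(1,2)] \<open>0 < e\<close> by (metis zero_less_divide_iff zero_less_numeral)
  obtain Q where Q: "Q \<in> couplings \<nu> \<kappa>" "tl_cost p v w Q < tl_inf p v \<nu> w \<kappa> + e / 3"
    using tl_inf_approx[OF prob(2,3)] \<open>0 < e\<close> by (metis zero_less_divide_iff zero_less_numeral)
  obtain D :: "('a \<times> real) set" where D: "countable D" "\<And>S. open S \<Longrightarrow> S \<noteq> {} \<Longrightarrow> \<exists>d\<in>D. d \<in> S"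
    using countable_dense_setE by blast
  define q where "q = from_nat_into D"
  \<comment> \<open>Points of one cell are less than 2\<delta> apart on the graph. The position and
    the value each differ by at most that, which adds up to 4\<delta> = e/3.\<close>
  define \<delta> where "\<delta> = e / 12"
  have "0 < \<delta>" using \<open>0 < e\<close> by (simp add: \<delta>_def)
  \<comment> \<open>The balls around the dense sequence cover the graph of v; taking the first
    suitable ball makes the cells disjoint. Using the graph controls the position and the value of v
    together.\<close>
  define c where "c y = (LEAST k. dist (y, v y) (q k) < \<delta>)" for y
  have c: "dist (y, v y) (q (c y)) < \<delta>" for y
  proof -
    obtain d where "d \<in> D" "d \<in> ball (y, v y) \<delta>"
      using D(2)[of "ball (y, v y) \<delta>"] \<open>0 < \<delta>\<close> by auto
    moreover obtain k where "q k = d"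
      using from_nat_into_surj[OF D(1) \<open>d \<in> D\<close>] by (auto simp: q_def)
    ultimately show ?thesis
      unfolding c_def using LeastI[of "\<lambda>k. dist (y, v y) (q k) < \<delta>" k] by simp
  qed
  have cell: "pnorm2 p (v y - v y') (norm (y - y')) \<le> e / 3" if "c y = c y'" for y y'
  proof -
    have d: "dist (y, v y) (y', v y') < 2 * \<delta>"
      using dist_triangle2[of "(y, v y)" "(y', v y')" "q (c y)"] c[of y] c[of y'] that by simp
    have "pnorm2 p (v y - v y') (norm (y - y')) \<le> dist (v y) (v y') + dist y y'"
      using pnorm2_le_add[OF p, of "v y - v y'" "norm (y - y')"] by (simp add: dist_norm)
    also have "\<dots> \<le> 2 * dist (y, v y) (y', v y')"
      using dist_fst_le[of "(y, v y)" "(y', v y')"] dist_snd_le[of "(y, v y)" "(y', v y')"] by simp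
    finally show ?thesis using d by (simp add: \<delta>_def)
  qed
  have [measurable]: "(\<lambda>x. x) \<in> borel_measurable \<nu>" using \<nu> by (auto intro: prob_measures_measurable)
  note [measurable] = Lp_funs_measurable[OF v]
  have [measurable]: "c \<in> \<nu> \<rightarrow>\<^sub>M count_space UNIV"
    unfolding c_def[abs_def] by measurable
  note [measurable] = couplings_measurable_snd[OF P(1)] couplings_measurable_fst[OF Q(1)]
  \<comment> \<open>Both plans have \<nu> as their middle marginal, so corresponding cells have the
    same mass.\<close>
  have "emeasure P {z \<in> space P. c (snd z) = k} = emeasure Q {z \<in> space Q. c (fst z) = k}" for k
  proof -
    have [measurable]: "{y \<in> space \<nu>. c y = k} \<in> sets \<nu>" by measurable
    have "emeasure P {z \<in> space P. c (snd z) = k} = emeasure (distr P \<nu> snd) {y \<in> space \<nu>. c y = k}"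
      by (subst emeasure_distr) (auto intro!: arg_cong[where f = "emeasure P"] simp: couplings_space[OF P(1)])
    also have "\<dots> = emeasure (distr Q \<nu> fst) {y \<in> space \<nu>. c y = k}"
      by (simp add: couplings_distr_snd[OF P(1)] couplings_distr_fst[OF Q(1)])
    also have "\<dots> = emeasure Q {z \<in> space Q. c (fst z) = k}"
      by (subst emeasure_distr) (auto intro!: arg_cong[where f = "emeasure Q"] simp: couplings_space[OF Q(1)])
    finally show ?thesis .
  qed
  then obtain \<gamma> where \<gamma>: "\<gamma> \<in> couplings P Q" "AE z in \<gamma>. c (snd (fst z)) = c (fst (snd z))"
    using coupling_of_cells[of P Q "\<lambda>z. c (snd z)" "\<lambda>z. c (fst z)"]
      couplings_prob_space[OF P(1)] couplings_prob_space[OF Q(1)] by auto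
  define \<pi> where "\<pi> = distr \<gamma> (\<mu> \<Otimes>\<^sub>M \<kappa>) (\<lambda>z. (fst (fst z), snd (snd z)))"
  have \<pi>: "\<pi> \<in> couplings \<mu> \<kappa>"
    unfolding \<pi>_def using P(1) Q(1) \<gamma>(1) by (rule coupling_compose)
  note gauge = tl_gauge_in_Lp_funs[OF \<mu> \<nu> P(1) u v] tl_gauge_in_Lp_funs[OF \<nu> \<kappa> Q(1) v w]
    tl_gauge_in_Lp_funs[OF \<mu> \<kappa> \<pi> u w]
  note [measurable] = couplings_measurable_fst[OF \<gamma>(1)] couplings_measurable_snd[OF \<gamma>(1)]
    couplings_measurable_fst[OF P(1)] couplings_measurable_snd[OF Q(1)]
  define f g h where "f z = tl_gauge p u v (fst z)" and "g z = tl_gauge p v w (snd z)"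
    and "h z = tl_gauge p u w (fst (fst z), snd (snd z))"
    for z :: "('a \<times> 'a) \<times> 'a \<times> 'a"
  have f: "f \<in> Lp_funs p \<gamma>" "Lp_norm p \<gamma> f = tl_cost p u v P"
    using gauge(1) Lp_funs_measurable[OF gauge(1)]
    by (auto simp: f_def[abs_def] tl_cost_def Lp_norm_coupling_fst[OF \<gamma>(1)] Lp_funs_coupling_fst[OF \<gamma>(1)])
  have g: "g \<in> Lp_funs p \<gamma>" "Lp_norm p \<gamma> g = tl_cost p v w Q"
    using gauge(2) Lp_funs_measurable[OF gauge(2)]
    by (auto simp: g_def[abs_def] tl_cost_def Lp_norm_coupling_snd[OF \<gamma>(1)] Lp_funs_coupling_snd[OF \<gamma>(1)])
  have [measurable]: "tl_gauge p u w \<in> borel_measurable (\<mu> \<Otimes>\<^sub>M \<kappa>)"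
    using Lp_funs_measurable[OF gauge(3)] by (simp add: \<pi>_def)
  have h: "h \<in> borel_measurable \<gamma>" "Lp_norm p \<gamma> h = tl_cost p u w \<pi>"
    by (auto simp: h_def[abs_def] tl_cost_def \<pi>_def Lp_norm_distr[where N = "\<mu> \<Otimes>\<^sub>M \<kappa>"])
  have const: "(\<lambda>_. e / 3) \<in> Lp_funs p \<gamma>"
    using prob_space.finite_measure[OF couplings_prob_space[OF \<gamma>(1)]] p
    by (intro Lp_funs_bounded[where B = "\<bar>e / 3\<bar>"]) auto
  \<comment> \<open>The detour from x to t passes through the middle points y and y' of the two
    plans; the leg between them stays inside one cell.\<close>
  have le: "AE z in \<gamma>. \<bar>h z\<bar> \<le> \<bar>f z + e / 3 + g z\<bar>"
    using \<gamma>(2)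
  proof eventually_elim
    case (elim z)
    obtain x y y' t where z: "z = ((x, y), (y', t))" by (metis prod.exhaust)
    have "norm (x - t) \<le> norm (x - y) + (norm (y - y') + norm (y' - t))"
      using dist_triangle[of x t y] dist_triangle[of y t y'] by (simp add: dist_norm)
    then have "h z \<le> pnorm2 p ((u x - v y) + ((v y - v y') + (v y' - w t)))
        (norm (x - y) + (norm (y - y') + norm (y' - t)))"
      using p by (auto simp: h_def z tl_gauge_def intro!: pnorm2_mono)
    also have "\<dots> \<le> pnorm2 p (u x - v y) (norm (x - y))
        + (pnorm2 p (v y - v y') (norm (y - y')) + pnorm2 p (v y' - w t) (norm (y' - t)))"
      by (intro order_trans[OF pnorm2_triangle[OF p]] add_left_mono pnorm2_triangle p)
    also have "\<dots> \<le> f z + e / 3 + g z"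
      using cell[of y y'] elim by (simp add: z f_def g_def tl_gauge_def)
    finally have "h z \<le> f z + e / 3 + g z" .
    moreover have "0 \<le> h z" by (simp add: h_def tl_gauge_def pnorm2_nonneg)
    ultimately show ?case by linarith
  qed
  have "tl_inf p u \<mu> w \<kappa> \<le> Lp_norm p \<gamma> h"
    using tl_inf_le_cost[OF \<pi>] h(2) by metis
  also have "\<dots> \<le> Lp_norm p \<gamma> (\<lambda>z. f z + e / 3 + g z)"
    using f(1) g(1) const h(1) le p by (intro Lp_norm_mono Lp_funs_add) auto
  also have "\<dots> \<le> Lp_norm p \<gamma> (\<lambda>z. f z + e / 3) + Lp_norm p \<gamma> g"
    using f(1) g(1) const p by (intro Lp_norm_triangle Lp_funs_add)
  also have "\<dots> \<le> Lp_norm p \<gamma> f + Lp_norm p \<gamma> (\<lambda>z. e / 3) + Lp_norm p \<gamma> g"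
    using f(1) const p by (intro add_right_mono Lp_norm_triangle)
  also have "Lp_norm p \<gamma> (\<lambda>z. e / 3) = e / 3"
    using couplings_prob_space[OF \<gamma>(1)] p \<open>0 < e\<close> by (intro Lp_norm_const) auto
  finally show "tl_inf p u \<mu> w \<kappa> \<le> tl_inf p u \<mu> v \<nu> + tl_inf p v \<nu> w \<kappa> + e"
    using P(2) Q(2) f(2) g(2) by linarith
qed

text \<open>On every plan the two norms are norms of functions of one marginal each, and the
  difference of these functions is bounded by the gauge.\<close>

lemma Lp_norm_le_tl_inf:
  assumes "\<mu> \<in> prob_measures p \<Omega>" "\<nu> \<in> prob_measures p \<Omega>" "u \<in> Lp_funs p \<mu>" "v \<in> Lp_funs p \<nu>"
  shows "Lp_norm p \<mu> u \<le> Lp_norm p \<nu> v + tl_inf p u \<mu> v \<nu>"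
proof -
  have "Lp_norm p \<mu> u - Lp_norm p \<nu> v \<le> tl_inf p u \<mu> v \<nu>"
  proof (rule tl_inf_greatest)
    fix \<pi> assume \<pi>: "\<pi> \<in> couplings \<mu> \<nu>"
    note meas = Lp_funs_measurable[OF assms(3)] Lp_funs_measurable[OF assms(4)]
    have uv: "(\<lambda>z. u (fst z)) \<in> Lp_funs p \<pi>" "(\<lambda>z. v (snd z)) \<in> Lp_funs p \<pi>"
      using assms(3,4) meas by (auto simp: Lp_funs_coupling_fst[OF \<pi>] Lp_funs_coupling_snd[OF \<pi>])
    have "Lp_norm p \<pi> (\<lambda>z. u (fst z)) \<le> Lp_norm p \<pi> (\<lambda>z. v (snd z)) + Lp_norm p \<pi> (\<lambda>z. u (fst z) - v (snd z))"
      by (rule Lp_norm_triangle_diff[OF uv p])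
    also have "Lp_norm p \<pi> (\<lambda>z. u (fst z) - v (snd z)) \<le> tl_cost p u v \<pi>"
      unfolding tl_cost_def
      using Lp_funs_measurable[OF Lp_funs_diff[OF uv p]] order_trans[OF pnorm2_ge(1)[OF p] abs_ge_self] p
      by (intro Lp_norm_mono tl_gauge_in_Lp_funs[OF assms(1,2) \<pi> assms(3,4)]) (auto simp: tl_gauge_def)
    finally show "Lp_norm p \<mu> u - Lp_norm p \<nu> v \<le> tl_cost p u v \<pi>"
      using meas by (simp add: Lp_norm_coupling_fst[OF \<pi>] Lp_norm_coupling_snd[OF \<pi>])
  qed (use assms prob_measures_prob_space in auto)
  then show ?thesis by simp
qed

text \<open>The increment of \<phi> between x and y is at most L|x - y|, hence at most L times the
  gauge. The bound holds plan by plan, with the same plan on both sides.\<close>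

lemma tl_inf_add_lipschitz:
  assumes \<mu>: "\<mu> \<in> prob_measures p \<Omega>" and \<nu>: "\<nu> \<in> prob_measures p \<Omega>"
    and u: "u \<in> Lp_funs p \<mu>" and v: "v \<in> Lp_funs p \<nu>"
    and \<phi>: "\<phi> \<in> Lp_funs p \<mu>" "\<phi> \<in> Lp_funs p \<nu>" and L: "L-lipschitz_on UNIV \<phi>"
  shows "tl_inf p (\<lambda>x. u x + \<phi> x) \<mu> (\<lambda>x. v x + \<phi> x) \<nu> \<le> (1 + L) * tl_inf p u \<mu> v \<nu>"
proof -
  have "0 \<le> L" using L by (rule lipschitz_on_nonneg)
  \<comment> \<open>Dividing by 1 + L > 0 puts the claim into the form of a lower bound for the
    infimum on the right.\<close>
  have "tl_inf p (\<lambda>x. u x + \<phi> x) \<mu> (\<lambda>x. v x + \<phi> x) \<nu> / (1 + L) \<le> tl_inf p u \<mu> v \<nu>"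
  proof (rule tl_inf_greatest)
    fix \<pi> assume \<pi>: "\<pi> \<in> couplings \<mu> \<nu>"
    note gauge = tl_gauge_in_Lp_funs[OF \<mu> \<nu> \<pi> u v]
      tl_gauge_in_Lp_funs[OF \<mu> \<nu> \<pi> Lp_funs_add[OF u \<phi>(1) p] Lp_funs_add[OF v \<phi>(2) p]]
    have le: "\<bar>tl_gauge p (\<lambda>x. u x + \<phi> x) (\<lambda>x. v x + \<phi> x) z\<bar> \<le> \<bar>(1 + L) * tl_gauge p u v z\<bar>" for z
    proof -
      obtain x y where z: "z = (x, y)" by (metis prod.exhaust)
      have "pnorm2 p (u x + \<phi> x - (v y + \<phi> y)) (norm (x - y))
          \<le> pnorm2 p (u x - v y) (norm (x - y)) + pnorm2 p (\<phi> x - \<phi> y) 0"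
        using pnorm2_triangle[OF p, of "u x - v y" "\<phi> x - \<phi> y" "norm (x - y)" 0]
        by (simp add: algebra_simps)
      also have "pnorm2 p (\<phi> x - \<phi> y) 0 \<le> L * norm (x - y)"
        using lipschitz_onD[OF L, of x y] by (simp add: pnorm2_0 p dist_norm)
      also have "L * norm (x - y) \<le> L * pnorm2 p (u x - v y) (norm (x - y))"
        using pnorm2_ge(2)[OF p, of "norm (x - y)"] \<open>0 \<le> L\<close> by (intro mult_left_mono) auto
      finally show ?thesis
        using \<open>0 \<le> L\<close> pnorm2_nonneg by (simp add: z tl_gauge_def distrib_right)
    qed
    have "tl_cost p (\<lambda>x. u x + \<phi> x) (\<lambda>x. v x + \<phi> x) \<pi> \<le> Lp_norm p \<pi> (\<lambda>z. (1 + L) * tl_gauge p u v z)"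
      unfolding tl_cost_def using le p
      by (intro Lp_norm_mono Lp_funs_scale gauge Lp_funs_measurable[OF gauge(2)]) auto
    also have "\<dots> = (1 + L) * tl_cost p u v \<pi>"
      unfolding tl_cost_def Lp_norm_scale[OF p] using \<open>0 \<le> L\<close> by simp
    finally have "tl_inf p (\<lambda>x. u x + \<phi> x) \<mu> (\<lambda>x. v x + \<phi> x) \<nu> \<le> (1 + L) * tl_cost p u v \<pi>"
      using tl_inf_le_cost[OF \<pi>] by (rule order_trans[rotated])
    then show "tl_inf p (\<lambda>x. u x + \<phi> x) \<mu> (\<lambda>x. v x + \<phi> x) \<nu> / (1 + L) \<le> tl_cost p u v \<pi>"
      using \<open>0 \<le> L\<close> by (simp add: divide_le_eq mult.commute)
  qed (use \<mu> \<nu> prob_measures_prob_space in auto)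
  then show ?thesis using \<open>0 \<le> L\<close> by (simp add: divide_le_eq mult.commute)
qed

text \<open>Dropping the difference of values only lowers the gauge, so convergence in TL^p controls
  the Wasserstein distance of the measures.\<close>

lemma tl_inf_zero_le:
  assumes "\<mu> \<in> prob_measures p \<Omega>" "\<nu> \<in> prob_measures p \<Omega>" "u \<in> Lp_funs p \<mu>" "v \<in> Lp_funs p \<nu>"
  shows "tl_inf p (\<lambda>_. 0) \<mu> (\<lambda>_. 0) \<nu> \<le> tl_inf p u \<mu> v \<nu>"
proof (rule tl_inf_greatest)
  fix \<pi> assume \<pi>: "\<pi> \<in> couplings \<mu> \<nu>"
  have "\<bar>tl_gauge p (\<lambda>_. 0) (\<lambda>_. 0) z\<bar> \<le> \<bar>tl_gauge p u v z\<bar>" for z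
    by (auto simp: tl_gauge_def abs_of_nonneg[OF pnorm2_nonneg] intro!: pnorm2_mono p)
  then have "tl_cost p (\<lambda>_. 0) (\<lambda>_. 0) \<pi> \<le> tl_cost p u v \<pi>"
    unfolding tl_cost_def using p
    by (intro Lp_norm_mono tl_gauge_in_Lp_funs[OF assms(1,2) \<pi> assms(3,4)]
        Lp_funs_measurable[OF tl_gauge_in_Lp_funs[OF assms(1,2) \<pi> Lp_funs_zero Lp_funs_zero]]) auto
  then show "tl_inf p (\<lambda>_. 0) \<mu> (\<lambda>_. 0) \<nu> \<le> tl_cost p u v \<pi>"
    using tl_inf_le_cost[OF \<pi>] by (rule order_trans[rotated])
qed (use assms prob_measures_prob_space in auto)

end

section \<open>Density of Lipschitz functions\<close>

text \<open>Lipschitz on the whole ambient space and bounded, so that one and the same function lies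
  in L^p of all the measures and can be carried from one to another.\<close>

definition bounded_lipschitz :: "('a::metric_space \<Rightarrow> real) \<Rightarrow> bool" where
  "bounded_lipschitz \<phi> \<longleftrightarrow> (\<exists>L. L-lipschitz_on UNIV \<phi>) \<and> bounded (range \<phi>)"

lemma bounded_lipschitz_add:
  assumes "bounded_lipschitz \<phi>" "bounded_lipschitz \<psi>"
  shows "bounded_lipschitz (\<lambda>x. \<phi> x + \<psi> x)"
  using assms unfolding bounded_lipschitz_def
  by (auto intro: lipschitz_on_add bounded_plus_comp)

lemma bounded_lipschitz_cmult:
  assumes "bounded_lipschitz \<phi>"
  shows "bounded_lipschitz (\<lambda>x. c * \<phi> x)"
proof -
  have "bounded (range (\<lambda>x. c * \<phi> x))"
    using assms bounded_scaling[of "range \<phi>" c] by (simp add: bounded_lipschitz_def image_image)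
  then show ?thesis
    using assms unfolding bounded_lipschitz_def by (auto intro: lipschitz_on_cmult_real)
qed

lemma bounded_lipschitz_const: "bounded_lipschitz (\<lambda>x. c)"
  by (auto simp: bounded_lipschitz_def intro!: exI[of _ 0] lipschitz_on_constant)

lemma bounded_lipschitz_in_Lp_funs:
  assumes "\<mu> \<in> prob_measures p \<Omega>" "bounded_lipschitz \<phi>" "1 \<le> p"
  shows "\<phi> \<in> Lp_funs p \<mu>"
proof -
  obtain L B where L: "L-lipschitz_on UNIV \<phi>" and B: "\<And>x. \<bar>\<phi> x\<bar> \<le> B"
    using assms by (auto simp: bounded_lipschitz_def bounded_real)
  have "\<phi> \<in> borel_measurable \<mu>"
    using assms(1) lipschitz_on_continuous_on[OF L]
    by (intro prob_measures_measurable[OF assms(1)] borel_measurable_continuous_onI)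
  then show ?thesis
    using prob_space.finite_measure[OF prob_measures_prob_space[OF assms(1)]]
    by (intro Lp_funs_bounded[where B = B] B assms(3))
qed

lemma closed_indicator_approx:
  fixes C :: "'a::metric_space set"
  assumes "closed C"
  obtains \<phi> :: "nat \<Rightarrow> 'a \<Rightarrow> real" where "\<And>n. bounded_lipschitz (\<phi> n)"
    "\<And>n x. \<bar>\<phi> n x - indicator C x\<bar> \<le> 1" "\<And>x. (\<lambda>n. \<phi> n x) \<longlonglongrightarrow> indicator C x"
\<comment> \<open>\<open>infdist\<close> to the empty set is 0 by convention, and the formula of the
  other case would give the constant 1.\<close>
proof (cases "C = {}")
  case True
  show ?thesis
    using True by (intro that[of "\<lambda>_ _. 0"]) (auto simp: bounded_lipschitz_const)
next
  case False
  \<comment> \<open>This is 1 on C and vanishes at distance at least 1/n from C. Since C is closed,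
    points outside have positive distance and are eventually sent to 0.\<close>
  define \<phi> where "\<phi> n x = max 0 (1 - real n * infdist x C)" for n x
  have range: "0 \<le> \<phi> n x" "\<phi> n x \<le> 1" for n x
    by (auto simp: \<phi>_def infdist_nonneg)
  show ?thesis
  proof (rule that[of \<phi>])
    fix n x
    show "\<bar>\<phi> n x - indicator C x\<bar> \<le> 1"
      using range[of n x] by (auto simp: indicator_def)
    have "(real n)-lipschitz_on UNIV (\<phi> n)"
    proof (rule lipschitz_onI)
      fix y z
      have "\<bar>\<phi> n y - \<phi> n z\<bar> \<le> \<bar>real n * infdist y C - real n * infdist z C\<bar>"
        by (auto simp: \<phi>_def max_def)
      also have "\<dots> = real n * \<bar>infdist y C - infdist z C\<bar>"
        by (simp add: abs_mult flip: right_diff_distrib)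
      also have "\<dots> \<le> real n * dist y z"
        by (intro mult_left_mono infdist_triangle_abs) auto
      finally show "dist (\<phi> n y) (\<phi> n z) \<le> real n * dist y z"
        by (simp add: dist_real_def)
    qed simp
    then show "bounded_lipschitz (\<phi> n)"
      using range[of n] unfolding bounded_lipschitz_def
      by (auto simp: bounded_real intro!: exI[of "\<lambda>a. \<forall>x\<in>range (\<phi> n). \<bar>x\<bar> \<le> a" 1])
    show "(\<lambda>n. \<phi> n x) \<longlonglongrightarrow> indicator C x"
    proof (cases "x \<in> C")
      case True
      then show ?thesis by (simp add: \<phi>_def)
    next
      case False
      then have pos: "0 < infdist x C"
        using assms \<open>C \<noteq> {}\<close> by (intro infdist_pos_not_in_closed) auto
      then obtain N where N: "1 < real N * infdist x C"
        using reals_Archimedean3 by blast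
      have "\<phi> n x = 0" if "N \<le> n" for n
      proof -
        have "real N * infdist x C \<le> real n * infdist x C"
          using that pos by (intro mult_right_mono) auto
        then show ?thesis using N by (simp add: \<phi>_def)
      qed
      then have "eventually (\<lambda>n. \<phi> n x = 0) sequentially"
        by (auto simp: eventually_sequentially)
      then show ?thesis using False by (simp add: tendsto_eventually)
    qed
  qed
qed

section \<open>From closed sets to all of L^p for a fixed measure\<close>

context
  fixes p :: real and \<Omega> :: "'a::euclidean_space set" and \<mu> :: "'a measure"
  assumes p: "1 \<le> p" and \<mu>: "\<mu> \<in> prob_measures p \<Omega>"
begin

lemma Lp_norm_indicator_approx:
  assumes "closed C" "\<And>n x. \<bar>\<phi> n x - indicator C x\<bar> \<le> 1" "\<And>n. bounded_lipschitz (\<phi> n)"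
    "\<And>x. (\<lambda>n. \<phi> n x) \<longlonglongrightarrow> indicator C x"
  shows "(\<lambda>n. Lp_norm p \<mu> (\<lambda>x. \<phi> n x - indicator C x)) \<longlonglongrightarrow> 0"
proof (rule Lp_norm_dominated_convergence[OF bounded_lipschitz_in_Lp_funs[OF \<mu> bounded_lipschitz_const p]])
  show "\<phi> n \<in> borel_measurable \<mu>" for n
    using bounded_lipschitz_in_Lp_funs[OF \<mu> assms(3) p] by (rule Lp_funs_measurable)
  show "indicator C \<in> borel_measurable \<mu>"
    using assms(1) by (intro prob_measures_measurable[OF \<mu>]) auto
  show "AE x in \<mu>. \<bar>\<phi> n x - indicator C x\<bar> \<le> \<bar>1\<bar>" for n
    using assms(2) by simp
qed (use assms p in auto)

lemma indicator_in_Lp_funs: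
  assumes "A \<in> sets \<mu>"
  shows "indicator A \<in> Lp_funs p \<mu>"
  using prob_space.finite_measure[OF prob_measures_prob_space[OF \<mu>]] assms p
  by (intro Lp_funs_bounded[where B = 1]) (auto simp: indicator_def)

lemma Lp_norm_indicator:
  assumes "A \<in> sets \<mu>"
  shows "Lp_norm p \<mu> (indicator A) = measure \<mu> A powr (1 / p)"
proof -
  have "(LINT x|\<mu>. \<bar>indicator A x :: real\<bar> powr p) = (LINT x|\<mu>. indicator A x)"
    using p by (intro Bochner_Integration.integral_cong) (auto simp: indicator_def)
  then show ?thesis
    using assms sets.sets_into_space[OF assms] by (simp add: Lp_norm_def Int_absorb2)
qed

text \<open>Pushing forward along the inclusion turns a measure on the Borel sets of \<Omega> into
  one on \<open>borel\<close>, where inner regularity and the generator argument with closed sets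
  apply.\<close>

lemma distr_borel: "sets (distr \<mu> borel (\<lambda>x. x)) = sets borel" "prob_space (distr \<mu> borel (\<lambda>x. x))"
  using \<mu> prob_measures_measurable[OF \<mu>, of "\<lambda>x. x" borel]
  by (auto intro: prob_space.prob_space_distr prob_measures_prob_space)

lemma sets_prob_measuresE:
  assumes "A \<in> sets \<mu>"
  obtains B where "B \<in> sets borel" "A = \<Omega> \<inter> B"
  using assms prob_measures_sets[OF \<mu>] by (auto simp: sets_restrict_space)

lemma space_prob_measures: "space \<mu> = \<Omega>"
  using sets_eq_imp_space_eq[OF prob_measures_sets[OF \<mu>]] by (simp add: space_restrict_space)

lemma sets_prob_measuresI: "B \<in> sets borel \<Longrightarrow> \<Omega> \<inter> B \<in> sets \<mu>"
  using prob_measures_sets[OF \<mu>] by (auto simp: sets_restrict_space)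

lemma measure_distr_borel: "B \<in> sets borel \<Longrightarrow> measure (distr \<mu> borel (\<lambda>x. x)) B = measure \<mu> (\<Omega> \<inter> B)"
  using prob_measures_measurable[OF \<mu>, of "\<lambda>x. x" borel]
  by (subst measure_distr) (auto simp: space_prob_measures Int_commute)

text \<open>Inner regularity replaces the set by a compact K of almost the same mass, and K is
  closed, so its indicator is a limit of bounded Lipschitz functions.\<close>

lemma lipschitz_dense_indicator:
  assumes "A \<in> sets \<mu>" "0 < e"
  shows "\<exists>\<phi>. bounded_lipschitz \<phi> \<and> Lp_norm p \<mu> (\<lambda>x. indicator A x - \<phi> x) < e"
proof -
  obtain B where B: "B \<in> sets borel" "A = \<Omega> \<inter> B"
    using assms(1) by (rule sets_prob_measuresE)
  let ?M = "distr \<mu> borel (\<lambda>x. x)"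
  interpret M: prob_space ?M by (rule distr_borel)
  \<comment> \<open>The norm of an indicator is the p-th root of the mass, so a mass defect below
    this \<eta> costs less than e/2 in norm.\<close>
  define \<eta> where "\<eta> = (e / 2) powr p"
  have "0 < \<eta>" using assms by (simp add: \<eta>_def)
  have "\<exists>K\<in>{K. K \<subseteq> B \<and> compact K}. emeasure ?M B < emeasure ?M K + ennreal \<eta>"
  proof (rule SUP_approx_ennreal[OF \<open>0 < \<eta>\<close>])
    show "emeasure ?M B = (SUP K\<in>{K. K \<subseteq> B \<and> compact K}. emeasure ?M K)"
      using distr_borel(1) M.emeasure_finite B(1) by (intro inner_regular) simp_all
  qed auto
  then obtain K where K: "K \<subseteq> B" "compact K" "emeasure ?M B < emeasure ?M K + ennreal \<eta>"
    by auto
  then have "closed K" by (auto intro: compact_imp_closed)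
  then have [measurable]: "K \<in> sets borel" by simp
  have "measure ?M B < measure ?M K + \<eta>"
    using K(3) \<open>0 < \<eta>\<close>
    by (simp add: M.emeasure_eq_measure ennreal_less_iff flip: ennreal_plus)
  then have "measure ?M (B - K) < \<eta>"
    using M.finite_measure_Diff[of B K] B(1) K(1) by simp
  then have small: "measure \<mu> (\<Omega> \<inter> (B - K)) < \<eta>"
    using B(1) by (simp add: measure_distr_borel)
  have "Lp_norm p \<mu> (\<lambda>x. indicator A x - indicator K x) = Lp_norm p \<mu> (indicator (\<Omega> \<inter> (B - K)))"
    using B K(1) by (intro Lp_norm_cong) (auto simp: space_prob_measures indicator_def)
  also have "\<dots> < \<eta> powr (1 / p)"
    using small p B(1) by (subst Lp_norm_indicator) (auto intro!: powr_less_mono2 sets_prob_measuresI)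
  also have "\<dots> = e / 2"
    using p assms by (simp add: \<eta>_def powr_powr)
  finally have AK: "Lp_norm p \<mu> (\<lambda>x. indicator A x - indicator K x) < e / 2" .
  obtain \<phi> where \<phi>: "\<And>n. bounded_lipschitz (\<phi> n)" "\<And>n x. \<bar>\<phi> n x - indicator K x\<bar> \<le> 1"
    "\<And>x. (\<lambda>n. \<phi> n x) \<longlonglongrightarrow> indicator K x"
    using closed_indicator_approx[OF \<open>closed K\<close>] by blast
  have "(\<lambda>n. Lp_norm p \<mu> (\<lambda>x. \<phi> n x - indicator K x)) \<longlonglongrightarrow> 0"
    using \<open>closed K\<close> \<phi> by (intro Lp_norm_indicator_approx)
  then have "eventually (\<lambda>n. Lp_norm p \<mu> (\<lambda>x. \<phi> n x - indicator K x) < e / 2) sequentially"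
    by (rule order_tendstoD) (use assms in auto)
  then obtain n where n: "Lp_norm p \<mu> (\<lambda>x. \<phi> n x - indicator K x) < e / 2"
    by (auto simp: eventually_sequentially)
  have ind: "indicator K \<in> Lp_funs p \<mu>"
    using prob_space.finite_measure[OF prob_measures_prob_space[OF \<mu>]] p
    by (intro Lp_funs_bounded[where B = 1] prob_measures_measurable[OF \<mu>]) (auto simp: indicator_def)
  have "Lp_norm p \<mu> (\<lambda>x. indicator A x - \<phi> n x)
      \<le> Lp_norm p \<mu> (\<lambda>x. indicator A x - indicator K x) + Lp_norm p \<mu> (\<lambda>x. indicator K x - \<phi> n x)"
    by (rule Lp_norm_diff_triangle[OF indicator_in_Lp_funs[OF assms(1)] ind
        bounded_lipschitz_in_Lp_funs[OF \<mu> \<phi>(1) p] p])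
  also have "\<dots> < e"
    using AK n Lp_norm_minus_commute[of p \<mu> "\<phi> n" "indicator K"] by simp
  finally show ?thesis using \<phi>(1) by blast
qed

text \<open>Induction over nonnegative measurable functions. Membership in L^p is a premise, so each
  case must derive it for the pieces: by rescaling for multiples, and by domination for sums and
  increasing limits.\<close>

lemma lipschitz_dense_nonneg:
  assumes "u \<in> borel_measurable \<mu>" "\<And>x. 0 \<le> u x" "u \<in> Lp_funs p \<mu>" "0 < e"
  shows "\<exists>\<phi>. bounded_lipschitz \<phi> \<and> Lp_norm p \<mu> (\<lambda>x. u x - \<phi> x) < e"
  using assms
proof (induction u arbitrary: e rule: borel_measurable_induct_real)
  case (set A)
  then show ?case by (intro lipschitz_dense_indicator)
next
  case (mult u c)
  show ?case
  proof (cases "c = 0")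
    case True
    then show ?thesis
      using \<open>0 < e\<close> p by (intro exI[of _ "\<lambda>_. 0"]) (simp add: bounded_lipschitz_const Lp_norm_def)
  next
    case False
    then have "u \<in> Lp_funs p \<mu>"
      using Lp_funs_scale[OF mult.prems(1), of "1 / c"] by simp
    then obtain \<phi> where \<phi>: "bounded_lipschitz \<phi>" "Lp_norm p \<mu> (\<lambda>x. u x - \<phi> x) < e / c"
      using mult.IH[of "e / c"] False mult.prems mult.hyps by auto
    have "Lp_norm p \<mu> (\<lambda>x. c * u x - c * \<phi> x) = c * Lp_norm p \<mu> (\<lambda>x. u x - \<phi> x)"
      using Lp_norm_scale[OF p, of \<mu> c "\<lambda>x. u x - \<phi> x"] mult.hyps by (simp add: right_diff_distrib)
    also have "\<dots> < e"
      using \<phi>(2) False mult.hyps by (simp add: field_simps)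
    finally show ?thesis using bounded_lipschitz_cmult[OF \<phi>(1)] by blast
  qed
next
  case (add u v)
  have uv: "u \<in> Lp_funs p \<mu>" "v \<in> Lp_funs p \<mu>"
    using add.hyps by (auto intro!: Lp_funs_mono[OF add.prems(1) _ _ p])
  obtain \<phi> where \<phi>: "bounded_lipschitz \<phi>" "Lp_norm p \<mu> (\<lambda>x. u x - \<phi> x) < e / 2"
    using add.IH(1)[OF uv(1), of "e / 2"] add.prems by auto
  obtain \<psi> where \<psi>: "bounded_lipschitz \<psi>" "Lp_norm p \<mu> (\<lambda>x. v x - \<psi> x) < e / 2"
    using add.IH(2)[OF uv(2), of "e / 2"] add.prems by auto
  have "Lp_norm p \<mu> (\<lambda>x. (v x + u x) - (\<psi> x + \<phi> x))
      = Lp_norm p \<mu> (\<lambda>x. (v x - \<psi> x) + (u x - \<phi> x))"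
    by (simp add: algebra_simps)
  also have "\<dots> \<le> Lp_norm p \<mu> (\<lambda>x. v x - \<psi> x) + Lp_norm p \<mu> (\<lambda>x. u x - \<phi> x)"
    using uv \<phi> \<psi> p by (intro Lp_norm_triangle Lp_funs_diff
        bounded_lipschitz_in_Lp_funs[OF \<mu> \<phi>(1) p] bounded_lipschitz_in_Lp_funs[OF \<mu> \<psi>(1) p]) auto
  also have "\<dots> < e" using \<phi> \<psi> by simp
  finally show ?case using bounded_lipschitz_add[OF \<psi>(1) \<phi>(1)] by blast
next
  case (seq U)
  have le: "U i x \<le> u x" if "x \<in> space \<mu>" for i x
    using seq.hyps(3) seq.hyps(4)[OF that] by (intro incseq_le) (auto simp: incseq_def le_fun_def)
  have U: "U i \<in> Lp_funs p \<mu>" for i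
    using seq.hyps le by (intro Lp_funs_mono[OF seq.prems(1) _ _ p]) (auto intro!: order_trans[OF le])
  have "(\<lambda>i. Lp_norm p \<mu> (\<lambda>x. U i x - u x)) \<longlonglongrightarrow> 0"
  proof (rule Lp_norm_dominated_convergence[OF seq.prems(1) _ _ _ _ p])
    show "AE x in \<mu>. \<bar>U i x - u x\<bar> \<le> \<bar>u x\<bar>" for i
      \<comment> \<open>The approximants lie between 0 and u, so u itself dominates the
        differences.\<close>
      using seq.hyps(2)[of i] le[of _ i] by (intro AE_I2) (smt (verit))
  qed (use seq.hyps seq.prems(1) in \<open>auto intro: Lp_funs_measurable\<close>)
  then have "eventually (\<lambda>i. Lp_norm p \<mu> (\<lambda>x. U i x - u x) < e / 2) sequentially"
    by (rule order_tendstoD) (use seq.prems in auto)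
  then obtain i where i: "Lp_norm p \<mu> (\<lambda>x. U i x - u x) < e / 2"
    by (auto simp: eventually_sequentially)
  obtain \<phi> where \<phi>: "bounded_lipschitz \<phi>" "Lp_norm p \<mu> (\<lambda>x. U i x - \<phi> x) < e / 2"
    using seq.IH[OF U, of "e / 2" i] seq.prems by auto
  have "Lp_norm p \<mu> (\<lambda>x. u x - \<phi> x) \<le> Lp_norm p \<mu> (\<lambda>x. u x - U i x) + Lp_norm p \<mu> (\<lambda>x. U i x - \<phi> x)"
    using seq.prems(1) U \<phi> p by (intro Lp_norm_diff_triangle bounded_lipschitz_in_Lp_funs[OF \<mu> \<phi>(1)]) auto
  also have "\<dots> < e"
    using i \<phi>(2) Lp_norm_minus_commute[of p \<mu> "U i" u] by simp
  finally show ?case using \<phi>(1) by blast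
qed

lemma lipschitz_dense:
  assumes u: "u \<in> Lp_funs p \<mu>" and "0 < e"
  shows "\<exists>\<phi>. bounded_lipschitz \<phi> \<and> Lp_norm p \<mu> (\<lambda>x. u x - \<phi> x) < e"
proof -
  note [measurable] = Lp_funs_measurable[OF u]
  have pm: "(\<lambda>x. max 0 (u x)) \<in> Lp_funs p \<mu>" "(\<lambda>x. max 0 (- u x)) \<in> Lp_funs p \<mu>"
    by (rule Lp_funs_mono[OF u _ _ p], auto)+
  obtain \<phi> where \<phi>: "bounded_lipschitz \<phi>" "Lp_norm p \<mu> (\<lambda>x. max 0 (u x) - \<phi> x) < e / 2"
    using lipschitz_dense_nonneg[of "\<lambda>x. max 0 (u x)" "e / 2"] pm(1) \<open>0 < e\<close> by auto
  obtain \<psi> where \<psi>: "bounded_lipschitz \<psi>" "Lp_norm p \<mu> (\<lambda>x. max 0 (- u x) - \<psi> x) < e / 2"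
    using lipschitz_dense_nonneg[of "\<lambda>x. max 0 (- u x)" "e / 2"] pm(2) \<open>0 < e\<close> by auto
  have "Lp_norm p \<mu> (\<lambda>x. u x - (\<phi> x + - 1 * \<psi> x))
      = Lp_norm p \<mu> (\<lambda>x. (max 0 (u x) - \<phi> x) + - 1 * (max 0 (- u x) - \<psi> x))"
    by (rule Lp_norm_cong) (auto simp: max_def)
  also have "\<dots> \<le> Lp_norm p \<mu> (\<lambda>x. max 0 (u x) - \<phi> x) + Lp_norm p \<mu> (\<lambda>x. - 1 * (max 0 (- u x) - \<psi> x))"
    using pm \<phi> \<psi> p by (intro Lp_norm_triangle Lp_funs_scale Lp_funs_diff
        bounded_lipschitz_in_Lp_funs[OF \<mu> \<phi>(1) p] bounded_lipschitz_in_Lp_funs[OF \<mu> \<psi>(1) p]) auto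
  also have "\<dots> < e"
    using \<phi> \<psi> unfolding Lp_norm_scale[OF p] by simp
  finally show ?thesis
    using bounded_lipschitz_add[OF \<phi>(1) bounded_lipschitz_cmult[OF \<psi>(1)]] by blast
qed

end

section \<open>Separation of points\<close>

context
  fixes p :: real and \<Omega> :: "'a::euclidean_space set"
  assumes p: "1 \<le> p"
begin

text \<open>The central estimate: the error of approximating u by \<phi> under \<mu> is controlled
  by the error of approximating v by the same \<phi> under \<nu>. Subtracting \<phi> costs the
  factor 1 + L, and norms vary by at most the distance.\<close>

lemma Lp_norm_diff_lipschitz_le:
  assumes \<mu>: "\<mu> \<in> prob_measures p \<Omega>" and \<nu>: "\<nu> \<in> prob_measures p \<Omega>"
    and u: "u \<in> Lp_funs p \<mu>" and v: "v \<in> Lp_funs p \<nu>"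
    and \<phi>: "bounded_lipschitz \<phi>" "L-lipschitz_on UNIV \<phi>"
  shows "Lp_norm p \<mu> (\<lambda>x. u x - \<phi> x) \<le> Lp_norm p \<nu> (\<lambda>x. v x - \<phi> x) + (1 + L) * tl_inf p u \<mu> v \<nu>"
proof -
  have m\<phi>: "(\<lambda>x. - \<phi> x) \<in> Lp_funs p \<mu>" "(\<lambda>x. - \<phi> x) \<in> Lp_funs p \<nu>"
    using bounded_lipschitz_in_Lp_funs[OF \<mu> bounded_lipschitz_cmult[OF \<phi>(1), of "-1"] p]
      bounded_lipschitz_in_Lp_funs[OF \<nu> bounded_lipschitz_cmult[OF \<phi>(1), of "-1"] p] by simp_all
  have "L-lipschitz_on UNIV (\<lambda>x. - \<phi> x)"
    using \<phi>(2) by simp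
  then have "tl_inf p (\<lambda>x. u x + - \<phi> x) \<mu> (\<lambda>x. v x + - \<phi> x) \<nu> \<le> (1 + L) * tl_inf p u \<mu> v \<nu>"
    by (rule tl_inf_add_lipschitz[OF p \<mu> \<nu> u v m\<phi>])
  moreover have "Lp_norm p \<mu> (\<lambda>x. u x + - \<phi> x)
      \<le> Lp_norm p \<nu> (\<lambda>x. v x + - \<phi> x) + tl_inf p (\<lambda>x. u x + - \<phi> x) \<mu> (\<lambda>x. v x + - \<phi> x) \<nu>"
    using Lp_funs_add[OF u m\<phi>(1) p] Lp_funs_add[OF v m\<phi>(2) p]
    by (rule Lp_norm_le_tl_inf[OF p \<mu> \<nu>])
  ultimately show ?thesis by simp
qed

lemma Lp_norm_lipschitz_le:
  assumes \<mu>: "\<mu> \<in> prob_measures p \<Omega>" and \<nu>: "\<nu> \<in> prob_measures p \<Omega>"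
    and \<phi>: "bounded_lipschitz \<phi>" and zero: "tl_inf p (\<lambda>_. 0) \<mu> (\<lambda>_. 0) \<nu> = 0"
  shows "Lp_norm p \<mu> \<phi> \<le> Lp_norm p \<nu> \<phi>"
proof -
  obtain L where "L-lipschitz_on UNIV \<phi>"
    using \<phi> by (auto simp: bounded_lipschitz_def)
  from Lp_norm_diff_lipschitz_le[OF \<mu> \<nu> Lp_funs_zero Lp_funs_zero \<phi> this] zero
  have "Lp_norm p \<mu> (\<lambda>x. - \<phi> x) \<le> Lp_norm p \<nu> (\<lambda>x. - \<phi> x)" by simp
  then show ?thesis by (simp add: Lp_norm_def)
qed

text \<open>Bounded Lipschitz functions decreasing to the indicator of a closed set have norms
  tending to the p-th root of its mass. Hence the measures agree on closed sets, which are stable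
  under intersection and generate the Borel sets.\<close>

lemma prob_measures_eqI:
  assumes \<mu>: "\<mu> \<in> prob_measures p \<Omega>" and \<nu>: "\<nu> \<in> prob_measures p \<Omega>"
    and eq: "\<And>\<phi>. bounded_lipschitz \<phi> \<Longrightarrow> Lp_norm p \<mu> \<phi> = Lp_norm p \<nu> \<phi>"
  shows "\<mu> = \<nu>"
proof -
  let ?\<mu> = "distr \<mu> borel (\<lambda>x. x)" and ?\<nu> = "distr \<nu> borel (\<lambda>x. x)"
  interpret M: prob_space ?\<mu> by (rule distr_borel[OF p \<mu>])
  interpret N: prob_space ?\<nu> by (rule distr_borel[OF p \<nu>])
  have closed: "measure \<mu> (\<Omega> \<inter> C) = measure \<nu> (\<Omega> \<inter> C)" if C: "closed C" for C
  proof -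
    obtain \<phi> where \<phi>: "\<And>n. bounded_lipschitz (\<phi> n)" "\<And>n x. \<bar>\<phi> n x - indicator C x\<bar> \<le> 1"
      "\<And>x. (\<lambda>n. \<phi> n x) \<longlonglongrightarrow> indicator C x"
      using closed_indicator_approx[OF C] by blast
    have lim: "(\<lambda>n. Lp_norm p \<kappa> (\<phi> n)) \<longlonglongrightarrow> measure \<kappa> (\<Omega> \<inter> C) powr (1 / p)"
      if \<kappa>: "\<kappa> \<in> prob_measures p \<Omega>" for \<kappa>
    proof -
      have [measurable]: "C \<in> sets borel" using C by simp
      have ind: "indicator C \<in> Lp_funs p \<kappa>"
        using prob_space.finite_measure[OF prob_measures_prob_space[OF \<kappa>]] p
        by (intro Lp_funs_bounded[where B = 1] prob_measures_measurable[OF \<kappa>]) (auto simp: indicator_def)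
      have "(\<lambda>n. Lp_norm p \<kappa> (\<phi> n)) \<longlonglongrightarrow> Lp_norm p \<kappa> (indicator C)"
      proof (rule LIM_zero_cancel, rule Lim_null_comparison)
        show "(\<lambda>n. Lp_norm p \<kappa> (\<lambda>x. \<phi> n x - indicator C x)) \<longlonglongrightarrow> 0"
          using C \<phi> by (intro Lp_norm_indicator_approx[OF p \<kappa>])
        show "\<forall>\<^sub>F n in sequentially. norm (Lp_norm p \<kappa> (\<phi> n) - Lp_norm p \<kappa> (indicator C))
            \<le> Lp_norm p \<kappa> (\<lambda>x. \<phi> n x - indicator C x)"
        proof (rule always_eventually, rule allI)
          fix n
          have "\<phi> n \<in> Lp_funs p \<kappa>" by (rule bounded_lipschitz_in_Lp_funs[OF \<kappa> \<phi>(1) p])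
          then show "norm (Lp_norm p \<kappa> (\<phi> n) - Lp_norm p \<kappa> (indicator C))
              \<le> Lp_norm p \<kappa> (\<lambda>x. \<phi> n x - indicator C x)"
            using Lp_norm_triangle_diff[of "\<phi> n" p \<kappa> "indicator C"] Lp_norm_triangle_diff[of "indicator C" p \<kappa> "\<phi> n"]
              Lp_norm_minus_commute[of p \<kappa> "indicator C" "\<phi> n"] ind p
            by (simp add: abs_le_iff)
        qed
      qed
      also have "Lp_norm p \<kappa> (indicator C) = Lp_norm p \<kappa> (indicator (\<Omega> \<inter> C))"
        by (rule Lp_norm_cong) (auto simp: space_prob_measures[OF p \<kappa>] indicator_def)
      finally show ?thesis
        by (simp add: Lp_norm_indicator[OF p \<kappa>] sets_prob_measuresI[OF p \<kappa>])
    qed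
    have "measure \<mu> (\<Omega> \<inter> C) powr (1 / p) = measure \<nu> (\<Omega> \<inter> C) powr (1 / p)"
      using lim[OF \<mu>] lim[OF \<nu>] by (simp add: eq[OF \<phi>(1)] LIMSEQ_unique)
    then have "(measure \<mu> (\<Omega> \<inter> C) powr (1 / p)) powr p = (measure \<nu> (\<Omega> \<inter> C) powr (1 / p)) powr p"
      by simp
    then show ?thesis using p by (simp add: powr_powr)
  qed
  have eq_distr: "?\<mu> = ?\<nu>"
  proof (rule measure_eqI_generator_eq[of "Collect closed" UNIV _ _ "\<lambda>_. UNIV"])
    show "emeasure ?\<mu> X = emeasure ?\<nu> X" if "X \<in> Collect closed" for X
      using that closed
      by (simp add: M.emeasure_eq_measure N.emeasure_eq_measure measure_distr_borel[OF p \<mu>] measure_distr_borel[OF p \<nu>])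
    show "sets ?\<mu> = sigma_sets UNIV (Collect closed)" "sets ?\<nu> = sigma_sets UNIV (Collect closed)"
      by (simp_all add: borel_eq_closed)
  qed (auto simp: Int_stable_def)
  interpret \<mu>: prob_space \<mu> using \<mu> by (rule prob_measures_prob_space)
  interpret \<nu>: prob_space \<nu> using \<nu> by (rule prob_measures_prob_space)
  show ?thesis
  proof (rule measure_eqI)
    show "sets \<mu> = sets \<nu>"
      using prob_measures_sets[OF \<mu>] prob_measures_sets[OF \<nu>] by simp
    fix A assume "A \<in> sets \<mu>"
    then obtain B where "B \<in> sets borel" "A = \<Omega> \<inter> B"
      by (rule sets_prob_measuresE[OF p \<mu>])
    then have "measure \<mu> A = measure \<nu> A"
      using measure_distr_borel[OF p \<mu>, of B] measure_distr_borel[OF p \<nu>, of B] eq_distr by simp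
    then show "emeasure \<mu> A = emeasure \<nu> A"
      by (simp add: \<mu>.emeasure_eq_measure \<nu>.emeasure_eq_measure)
  qed
qed

text \<open>The measures agree because their Wasserstein distance is 0. Then a Lipschitz function
  close to u is equally close to v.\<close>

lemma tl_inf_eq_0D:
  assumes \<mu>: "\<mu> \<in> prob_measures p \<Omega>" and \<nu>: "\<nu> \<in> prob_measures p \<Omega>"
    and u: "u \<in> Lp_funs p \<mu>" and v: "v \<in> Lp_funs p \<nu>" and zero: "tl_inf p u \<mu> v \<nu> = 0"
  shows "\<mu> = \<nu>" and "AE x in \<mu>. u x = v x"
proof -
  have "tl_inf p (\<lambda>_. 0) \<mu> (\<lambda>_. 0) \<nu> = 0"
    using tl_inf_zero_le[OF p \<mu> \<nu> u v] zero
      tl_inf_nonneg[OF p prob_measures_prob_space[OF \<mu>] prob_measures_prob_space[OF \<nu>], of "\<lambda>_. 0" "\<lambda>_. 0"]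
    by simp
  moreover from this have "tl_inf p (\<lambda>_. 0) \<nu> (\<lambda>_. 0) \<mu> = 0"
    using tl_inf_commute[OF p \<mu> \<nu> Lp_funs_zero Lp_funs_zero] by simp
  ultimately show "\<mu> = \<nu>"
    using \<mu> \<nu> by (intro prob_measures_eqI antisym Lp_norm_lipschitz_le) auto
  then have v': "v \<in> Lp_funs p \<mu>" and zero': "tl_inf p v \<mu> u \<mu> = 0"
    using v zero tl_inf_commute[OF p \<mu> \<nu> u v] by simp_all
  have "Lp_norm p \<mu> (\<lambda>x. u x - v x) \<le> 0"
  proof (rule field_le_epsilon)
    fix e :: real assume "0 < e"
    then obtain \<phi> where \<phi>: "bounded_lipschitz \<phi>" "Lp_norm p \<mu> (\<lambda>x. u x - \<phi> x) < e / 2"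
      using lipschitz_dense[OF p \<mu> u, of "e / 2"] by auto
    obtain L where L: "L-lipschitz_on UNIV \<phi>"
      using \<phi>(1) by (auto simp: bounded_lipschitz_def)
    \<comment> \<open>The size of L is harmless because 1 + L is multiplied by distance 0.\<close>
    have "Lp_norm p \<mu> (\<lambda>x. v x - \<phi> x) \<le> Lp_norm p \<mu> (\<lambda>x. u x - \<phi> x)"
      using Lp_norm_diff_lipschitz_le[OF \<mu> \<mu> v' u \<phi>(1) L] zero' by simp
    then show "Lp_norm p \<mu> (\<lambda>x. u x - v x) \<le> 0 + e"
      using Lp_norm_diff_triangle[OF u bounded_lipschitz_in_Lp_funs[OF \<mu> \<phi>(1) p] v' p] \<phi>(2)
        Lp_norm_minus_commute[of p \<mu> v \<phi>] by simp
  qed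
  then have "Lp_norm p \<mu> (\<lambda>x. u x - v x) = 0"
    using Lp_norm_nonneg by (intro antisym)
  then show "AE x in \<mu>. u x = v x"
    using Lp_norm_eq_0_iff[OF Lp_funs_diff[OF u v' p] p] by simp
qed

end

section \<open>The metric space \<open>TL\<^sup>p\<close>\<close>

lemma tl_cost_eq:
  assumes "1 \<le> p"
  shows "tl_cost p u v \<pi> = (LINT (x, y)|\<pi>. \<bar>u x - v y\<bar> powr p + norm (x - y) powr p) powr (1 / p)"
proof -
  have "\<bar>tl_gauge p u v z\<bar> powr p = (case z of (x, y) \<Rightarrow> \<bar>u x - v y\<bar> powr p + norm (x - y) powr p)" for z
    using assms by (simp add: tl_gauge_def pnorm2_def powr_powr case_prod_beta)
  then show ?thesis by (simp add: tl_cost_def Lp_norm_def)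
qed

section \<open>From functions to classes, and the metric axioms\<close>

context
  fixes p :: real and \<Omega> :: "'a::euclidean_space set"
  assumes p: "1 \<le> p"
begin

text \<open>Instead of comparing costs plan by plan, the triangle inequality is used: u and u' have
  distance 0 over \<mu>, and v and v' have distance 0 over \<nu>.\<close>

lemma tl_inf_cong_AE_le:
  assumes "\<mu> \<in> prob_measures p \<Omega>" "\<nu> \<in> prob_measures p \<Omega>"
    and "u \<in> Lp_funs p \<mu>" "u' \<in> Lp_funs p \<mu>" "AE x in \<mu>. u x = u' x"
    and "v \<in> Lp_funs p \<nu>" "v' \<in> Lp_funs p \<nu>" "AE x in \<nu>. v x = v' x"
  shows "tl_inf p u \<mu> v \<nu> \<le> tl_inf p u' \<mu> v' \<nu>"
proof -
  have "tl_inf p u \<mu> u' \<mu> \<le> 0"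
    using tl_inf_same_le[OF p assms(1,3,4)] Lp_norm_eq_0_iff[OF Lp_funs_diff[OF assms(3,4) p] p] assms(5)
    by simp
  moreover have "tl_inf p v' \<nu> v \<nu> \<le> 0"
    using tl_inf_same_le[OF p assms(2,7,6)] Lp_norm_eq_0_iff[OF Lp_funs_diff[OF assms(6,7) p] p] assms(8)
      Lp_norm_minus_commute[of p \<nu> v v']
    by simp
  ultimately show ?thesis
    using tl_inf_triangle[OF p assms(1,1,2,3,4,6)] tl_inf_triangle[OF p assms(1,2,2,4,7,6)] by linarith
qed

lemma TL_space_iff: "(U, \<mu>) \<in> TL_space p \<Omega> \<longleftrightarrow> \<mu> \<in> prob_measures p \<Omega> \<and> U \<in> carrier (Lp p \<mu>)"
  by (simp add: TL_space_def)

lemma TL_dist_eq: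
  assumes "(U, \<mu>) \<in> TL_space p \<Omega>" "(V, \<nu>) \<in> TL_space p \<Omega>"
  shows "TL_dist p \<Omega> (U, \<mu>) (V, \<nu>) = tl_inf p (Lp_rep U) \<mu> (Lp_rep V) \<nu>"
  using assms by (simp add: TL_dist_def tl_inf_def tl_cost_eq[OF p])

text \<open>Removes the choice made by \<open>Lp_rep\<close>: from here on the metric can be
  computed with any representatives.\<close>

lemma TL_dist_class:
  assumes "\<mu> \<in> prob_measures p \<Omega>" "\<nu> \<in> prob_measures p \<Omega>" "u \<in> Lp_funs p \<mu>" "v \<in> Lp_funs p \<nu>"
  shows "TL_dist p \<Omega> (Lp_class p \<mu> u, \<mu>) (Lp_class p \<nu> v, \<nu>) = tl_inf p u \<mu> v \<nu>"
proof -
  note uv = Lp_class_in_carrier[OF assms(3)] Lp_class_in_carrier[OF assms(4)]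
  have AE: "AE x in \<mu>. u x = Lp_rep (Lp_class p \<mu> u) x" "AE x in \<nu>. v x = Lp_rep (Lp_class p \<nu> v) x"
    using Lp_rep_Lp_class[OF assms(3)] Lp_rep_Lp_class[OF assms(4)] by (auto elim: eventually_mono)
  have "TL_dist p \<Omega> (Lp_class p \<mu> u, \<mu>) (Lp_class p \<nu> v, \<nu>)
      = tl_inf p (Lp_rep (Lp_class p \<mu> u)) \<mu> (Lp_rep (Lp_class p \<nu> v)) \<nu>"
    using assms uv by (intro TL_dist_eq) (auto simp: TL_space_iff)
  also have "\<dots> = tl_inf p u \<mu> v \<nu>"
    using assms uv AE Lp_rep_Lp_class
    by (intro antisym tl_inf_cong_AE_le Lp_rep_in_Lp_funs) auto
  finally show ?thesis .
qed

lemma TL_spaceE: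
  assumes "P \<in> TL_space p \<Omega>"
  obtains u \<mu> where "P = (Lp_class p \<mu> u, \<mu>)" "\<mu> \<in> prob_measures p \<Omega>" "u \<in> Lp_funs p \<mu>"
  using assms by (cases P) (auto simp: TL_space_iff carrier_Lp)

lemma Metric_space_TL: "Metric_space (TL_space p \<Omega>) (TL_dist p \<Omega>)"
proof
  fix P Q R :: "('a \<Rightarrow> real) set \<times> 'a measure"
  have outside: "TL_dist p \<Omega> P Q = 0" if "\<not> (P \<in> TL_space p \<Omega> \<and> Q \<in> TL_space p \<Omega>)" for P Q
    using that by (cases P, cases Q) (auto simp: TL_dist_def)
  show "0 \<le> TL_dist p \<Omega> P Q"
  proof (cases "P \<in> TL_space p \<Omega> \<and> Q \<in> TL_space p \<Omega>")
    case True
    then show ?thesis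
      by (auto elim!: TL_spaceE simp: TL_dist_class intro!: tl_inf_nonneg p prob_measures_prob_space)
  qed (simp add: outside)
  show "TL_dist p \<Omega> P Q = TL_dist p \<Omega> Q P"
  proof (cases "P \<in> TL_space p \<Omega> \<and> Q \<in> TL_space p \<Omega>")
    case True
    then show ?thesis
      by (auto elim!: TL_spaceE simp: TL_dist_class intro!: tl_inf_commute p)
  next
    case False
    then show ?thesis using outside[of P Q] outside[of Q P] by auto
  qed
  assume "P \<in> TL_space p \<Omega>" "Q \<in> TL_space p \<Omega>"
  then obtain u \<mu> v \<nu> where P: "P = (Lp_class p \<mu> u, \<mu>)" "\<mu> \<in> prob_measures p \<Omega>" "u \<in> Lp_funs p \<mu>"
    and Q: "Q = (Lp_class p \<nu> v, \<nu>)" "\<nu> \<in> prob_measures p \<Omega>" "v \<in> Lp_funs p \<nu>"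
    by (metis TL_spaceE)
  show "TL_dist p \<Omega> P Q = 0 \<longleftrightarrow> P = Q"
  proof
    assume "TL_dist p \<Omega> P Q = 0"
    then have "tl_inf p u \<mu> v \<nu> = 0"
      using P Q by (simp add: TL_dist_class)
    then have "\<mu> = \<nu>" "AE x in \<mu>. u x = v x"
      using tl_inf_eq_0D[OF p P(2) Q(2) P(3) Q(3)] by auto
    then show "P = Q"
      using P Q by (auto simp: Lp_class_eq_iff)
  next
    assume "P = Q"
    have "tl_inf p u \<mu> u \<mu> \<le> Lp_norm p \<mu> (\<lambda>x. 0)"
      using tl_inf_same_le[OF p P(2,3,3)] by simp
    then have "tl_inf p u \<mu> u \<mu> = 0"
      using tl_inf_nonneg[OF p prob_measures_prob_space[OF P(2)] prob_measures_prob_space[OF P(2)], of u u]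
      by (simp add: Lp_norm_def)
    then show "TL_dist p \<Omega> P Q = 0"
      using P TL_dist_class[OF P(2,2,3,3)] by (simp add: \<open>P = Q\<close>[symmetric])
  qed
  assume "R \<in> TL_space p \<Omega>"
  then obtain w \<kappa> where R: "R = (Lp_class p \<kappa> w, \<kappa>)" "\<kappa> \<in> prob_measures p \<Omega>" "w \<in> Lp_funs p \<kappa>"
    by (metis TL_spaceE)
  show "TL_dist p \<Omega> P R \<le> TL_dist p \<Omega> P Q + TL_dist p \<Omega> Q R"
    using P Q R tl_inf_triangle[OF p P(2) Q(2) R(2) P(3) Q(3) R(3)] by (simp add: TL_dist_class)
qed

lemma wasserstein_dist_eq:
  assumes "\<mu> \<in> prob_measures p \<Omega>" "\<nu> \<in> prob_measures p \<Omega>"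
  shows "wasserstein_dist p \<Omega> \<mu> \<nu> = tl_inf p (\<lambda>_. 0) \<mu> (\<lambda>_. 0) \<nu>"
  using assms p by (simp add: wasserstein_dist_def tl_inf_def tl_cost_eq[OF p])

lemma Metric_space_wasserstein: "Metric_space (prob_measures p \<Omega>) (wasserstein_dist p \<Omega>)"
proof
  note zero = Lp_funs_zero[of p]
  fix \<mu> \<nu> \<kappa> :: "'a measure"
  show "0 \<le> wasserstein_dist p \<Omega> \<mu> \<nu>"
  proof (cases "\<mu> \<in> prob_measures p \<Omega> \<and> \<nu> \<in> prob_measures p \<Omega>")
    case True
    then show ?thesis
      by (auto simp: wasserstein_dist_eq intro!: tl_inf_nonneg p prob_measures_prob_space)
  qed (auto simp: wasserstein_dist_def)
  show "wasserstein_dist p \<Omega> \<mu> \<nu> = wasserstein_dist p \<Omega> \<nu> \<mu>"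
  proof (cases "\<mu> \<in> prob_measures p \<Omega> \<and> \<nu> \<in> prob_measures p \<Omega>")
    case True
    then show ?thesis
      by (auto simp: wasserstein_dist_eq intro!: tl_inf_commute p zero)
  qed (auto simp: wasserstein_dist_def)
  assume \<mu>: "\<mu> \<in> prob_measures p \<Omega>" and \<nu>: "\<nu> \<in> prob_measures p \<Omega>"
  show "wasserstein_dist p \<Omega> \<mu> \<nu> = 0 \<longleftrightarrow> \<mu> = \<nu>"
  proof
    assume "wasserstein_dist p \<Omega> \<mu> \<nu> = 0"
    then show "\<mu> = \<nu>"
      using tl_inf_eq_0D(1)[OF p \<mu> \<nu> zero zero] by (simp add: wasserstein_dist_eq \<mu> \<nu>)
  next
    assume "\<mu> = \<nu>"
    then show "wasserstein_dist p \<Omega> \<mu> \<nu> = 0"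
      using tl_inf_same_le[OF p \<mu> zero zero]
        tl_inf_nonneg[OF p prob_measures_prob_space[OF \<mu>] prob_measures_prob_space[OF \<mu>], of "\<lambda>_. 0" "\<lambda>_. 0"]
      by (simp add: wasserstein_dist_eq \<nu> Lp_norm_def)
  qed
  assume \<kappa>: "\<kappa> \<in> prob_measures p \<Omega>"
  show "wasserstein_dist p \<Omega> \<mu> \<kappa> \<le> wasserstein_dist p \<Omega> \<mu> \<nu> + wasserstein_dist p \<Omega> \<nu> \<kappa>"
    using tl_inf_triangle[OF p \<mu> \<nu> \<kappa> zero zero zero] by (simp add: wasserstein_dist_eq \<mu> \<nu> \<kappa>)
qed


section \<open>Convergence along varying measures\<close>

text \<open>Triangle inequality along (u, \<mu>), (\<phi>, \<mu>), (\<phi>, \<nu>), (v, \<nu>). The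
  outer legs keep the measure and cost norms; the middle leg keeps the function and costs a multiple
  of the Wasserstein distance.\<close>

lemma tl_inf_le_via_lipschitz:
  assumes \<mu>: "\<mu> \<in> prob_measures p \<Omega>" and \<nu>: "\<nu> \<in> prob_measures p \<Omega>"
    and u: "u \<in> Lp_funs p \<mu>" and v: "v \<in> Lp_funs p \<nu>"
    and \<phi>: "bounded_lipschitz \<phi>" "L-lipschitz_on UNIV \<phi>"
  shows "tl_inf p u \<mu> v \<nu> \<le> Lp_norm p \<mu> (\<lambda>x. u x - \<phi> x) + (1 + L) * tl_inf p (\<lambda>_. 0) \<mu> (\<lambda>_. 0) \<nu>
    + Lp_norm p \<nu> (\<lambda>x. v x - \<phi> x)"
proof -
  note \<phi>' = bounded_lipschitz_in_Lp_funs[OF \<mu> \<phi>(1) p] bounded_lipschitz_in_Lp_funs[OF \<nu> \<phi>(1) p]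
  have "tl_inf p u \<mu> v \<nu> \<le> tl_inf p u \<mu> \<phi> \<mu> + tl_inf p \<phi> \<mu> v \<nu>"
    by (rule tl_inf_triangle[OF p \<mu> \<mu> \<nu> u \<phi>'(1) v])
  moreover have "tl_inf p \<phi> \<mu> v \<nu> \<le> tl_inf p \<phi> \<mu> \<phi> \<nu> + tl_inf p \<phi> \<nu> v \<nu>"
    by (rule tl_inf_triangle[OF p \<mu> \<nu> \<nu> \<phi>'(1,2) v])
  moreover have "tl_inf p \<phi> \<mu> \<phi> \<nu> \<le> (1 + L) * tl_inf p (\<lambda>_. 0) \<mu> (\<lambda>_. 0) \<nu>"
    using tl_inf_add_lipschitz[OF p \<mu> \<nu> Lp_funs_zero Lp_funs_zero \<phi>' \<phi>(2)] by simp
  ultimately show ?thesis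
    using tl_inf_same_le[OF p \<mu> u \<phi>'(1)] tl_inf_same_le[OF p \<nu> \<phi>'(2) v]
      Lp_norm_minus_commute[of p \<nu> v \<phi>] by linarith
qed

end

text \<open>K may depend on e. This matters because K will contain the Lipschitz constant of an
  approximant, over which there is no uniform control as e shrinks.\<close>

lemma tendsto_0_of_approx_bound:
  fixes s t :: "nat \<Rightarrow> real"
  assumes "\<And>n. 0 \<le> s n" "t \<longlonglongrightarrow> 0" "\<And>e. 0 < e \<Longrightarrow> \<exists>K. \<forall>n. s n \<le> e + K * t n"
  shows "s \<longlonglongrightarrow> 0"
proof (rule order_tendstoI)
  fix e :: real assume "0 < e"
  then obtain K where K: "\<And>n. s n \<le> e / 2 + K * t n"
    using assms(3)[of "e / 2"] by auto
  have "(\<lambda>n. e / 2 + K * t n) \<longlonglongrightarrow> e / 2 + K * 0"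
    by (intro tendsto_intros assms)
  then have "\<forall>\<^sub>F n in sequentially. e / 2 + K * t n < e"
    by (rule order_tendstoD) (use \<open>0 < e\<close> in auto)
  then show "\<forall>\<^sub>F n in sequentially. s n < e"
    by eventually_elim (use K in \<open>auto intro: le_less_trans\<close>)
next
  fix e :: real assume "e < 0"
  then show "\<forall>\<^sub>F n in sequentially. e < s n"
    using assms(1) by (intro always_eventually allI) (rule less_le_trans)
qed

text \<open>Choosing each element within 1/(n + 1) of the infimum at n replaces the usual diagonal
  extraction: smallness of the infima is then all that is needed.\<close>

lemma diagonal_choice:
  fixes f :: "nat \<Rightarrow> 'v \<Rightarrow> real"
  assumes nonempty: "\<And>n. A n \<noteq> {}" and nonneg: "\<And>n v. v \<in> A n \<Longrightarrow> 0 \<le> f n v"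
    and small: "\<And>e. 0 < e \<Longrightarrow> \<forall>\<^sub>F n in sequentially. \<exists>v\<in>A n. f n v < e"
  obtains v where "\<And>n. v n \<in> A n" "(\<lambda>n. f n (v n)) \<longlonglongrightarrow> 0"
proof -
  have bdd: "bdd_below (f n ` A n)" for n
    using nonneg by (intro bdd_belowI2[of _ 0]) auto
  have "\<exists>v\<in>A n. f n v < (INF v\<in>A n. f n v) + 1 / Suc n" for n
    using cINF_less_iff[OF nonempty bdd, of n "(INF v\<in>A n. f n v) + 1 / Suc n"] by simp
  then obtain v where v: "\<And>n. v n \<in> A n" "\<And>n. f n (v n) < (INF v\<in>A n. f n v) + 1 / Suc n"
    by metis
  have "(\<lambda>n. f n (v n)) \<longlonglongrightarrow> 0"
  proof (rule order_tendstoI)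
    fix e :: real assume "0 < e"
    have "(\<lambda>n. 1 / real (Suc n)) \<longlonglongrightarrow> 0"
      using LIMSEQ_inverse_real_of_nat by (simp add: inverse_eq_divide)
    then have "\<forall>\<^sub>F n in sequentially. 1 / real (Suc n) < e / 2"
      by (rule order_tendstoD) (use \<open>0 < e\<close> in auto)
    moreover have "\<forall>\<^sub>F n in sequentially. \<exists>v\<in>A n. f n v < e / 2"
      using \<open>0 < e\<close> by (intro small) auto
    ultimately show "\<forall>\<^sub>F n in sequentially. f n (v n) < e"
    proof eventually_elim
      case (elim n)
      then have "(INF v\<in>A n. f n v) < e / 2"
        using cINF_less_iff[OF nonempty bdd] by blast
      then show ?case using v(2)[of n] elim by linarith
    qed
  next
    fix e :: real assume "e < 0"
    then show "\<forall>\<^sub>F n in sequentially. e < f n (v n)"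
      using nonneg[OF v(1)] by (intro always_eventually allI) (rule less_le_trans)
  qed
  with v(1) show thesis by (rule that)
qed

section \<open>Sums, multiples, norms and recovery along a sequence of measures\<close>

context
  fixes p :: real and \<Omega> :: "'a::euclidean_space set"
    and \<mu> :: "nat \<Rightarrow> 'a measure" and \<nu> :: "'a measure"
  assumes p: "1 \<le> p" and \<mu>: "\<And>n. \<mu> n \<in> prob_measures p \<Omega>" and \<nu>: "\<nu> \<in> prob_measures p \<Omega>"
begin

lemma tl_inf_nonneg': "0 \<le> tl_inf p u (\<mu> n) v \<nu>"
  using p \<mu> \<nu> by (intro tl_inf_nonneg prob_measures_prob_space)

lemma tl_inf_tendsto_add:
  assumes u: "\<And>n. u n \<in> Lp_funs p (\<mu> n)" "u' \<in> Lp_funs p \<nu>" "(\<lambda>n. tl_inf p (u n) (\<mu> n) u' \<nu>) \<longlonglongrightarrow> 0"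
    and v: "\<And>n. v n \<in> Lp_funs p (\<mu> n)" "v' \<in> Lp_funs p \<nu>" "(\<lambda>n. tl_inf p (v n) (\<mu> n) v' \<nu>) \<longlonglongrightarrow> 0"
  shows "(\<lambda>n. tl_inf p (\<lambda>x. u n x + v n x) (\<mu> n) (\<lambda>x. u' x + v' x) \<nu>) \<longlonglongrightarrow> 0"
proof (rule tendsto_0_of_approx_bound)
  \<comment> \<open>The sum dominates both distances, and through them the Wasserstein distance, so
    a single null sequence drives all error terms.\<close>
  define t where "t n = tl_inf p (u n) (\<mu> n) u' \<nu> + tl_inf p (v n) (\<mu> n) v' \<nu>" for n
  show "t \<longlonglongrightarrow> 0"
    unfolding t_def[abs_def] using tendsto_add[OF u(3) v(3)] by simp
  show "0 \<le> tl_inf p (\<lambda>x. u n x + v n x) (\<mu> n) (\<lambda>x. u' x + v' x) \<nu>" for n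
    by (rule tl_inf_nonneg')
  fix e :: real assume "0 < e"
  \<comment> \<open>Each of the two approximation errors enters twice, once under \<nu> and once
    transferred to \<open>\<mu> n\<close>; four times e/4 makes e.\<close>
  obtain \<phi> where \<phi>: "bounded_lipschitz \<phi>" "Lp_norm p \<nu> (\<lambda>x. u' x - \<phi> x) < e / 4"
    using lipschitz_dense[OF p \<nu> u(2), of "e / 4"] \<open>0 < e\<close> by auto
  obtain \<psi> where \<psi>: "bounded_lipschitz \<psi>" "Lp_norm p \<nu> (\<lambda>x. v' x - \<psi> x) < e / 4"
    using lipschitz_dense[OF p \<nu> v(2), of "e / 4"] \<open>0 < e\<close> by auto
  obtain K L where K: "K-lipschitz_on UNIV \<phi>" and L: "L-lipschitz_on UNIV \<psi>"
    using \<phi>(1) \<psi>(1) by (auto simp: bounded_lipschitz_def)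
  note nonneg = lipschitz_on_nonneg[OF K] lipschitz_on_nonneg[OF L]
  have norm_add: "Lp_norm p \<kappa> (\<lambda>x. (f x + g x) - (\<phi> x + \<psi> x))
      \<le> Lp_norm p \<kappa> (\<lambda>x. f x - \<phi> x) + Lp_norm p \<kappa> (\<lambda>x. g x - \<psi> x)"
    if \<kappa>: "\<kappa> \<in> prob_measures p \<Omega>" and f: "f \<in> Lp_funs p \<kappa>" and g: "g \<in> Lp_funs p \<kappa>" for \<kappa> f g
  proof -
    have "(\<lambda>x. (f x + g x) - (\<phi> x + \<psi> x)) = (\<lambda>x. (f x - \<phi> x) + (g x - \<psi> x))"
      by (simp add: algebra_simps)
    then show ?thesis
      using Lp_norm_triangle[OF Lp_funs_diff[OF f bounded_lipschitz_in_Lp_funs[OF \<kappa> \<phi>(1) p] p]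
          Lp_funs_diff[OF g bounded_lipschitz_in_Lp_funs[OF \<kappa> \<psi>(1) p] p] p] by simp
  qed
  \<comment> \<open>The factors 1 + K and 1 + L come from transferring the errors of
    \<open>u n\<close> and \<open>v n\<close> to \<nu>. The last one comes from moving \<phi> +
    \<psi>, which is (K + L)-Lipschitz, between the measures.\<close>
  have "tl_inf p (\<lambda>x. u n x + v n x) (\<mu> n) (\<lambda>x. u' x + v' x) \<nu> \<le> e + ((1 + K) + (1 + L) + (1 + (K + L))) * t n" for n
  proof -
    have le_t: "tl_inf p (u n) (\<mu> n) u' \<nu> \<le> t n" "tl_inf p (v n) (\<mu> n) v' \<nu> \<le> t n"
      using tl_inf_nonneg' by (simp_all add: t_def)
    then have zero_le_t: "tl_inf p (\<lambda>_. 0) (\<mu> n) (\<lambda>_. 0) \<nu> \<le> t n"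
      using tl_inf_zero_le[OF p \<mu> \<nu> u(1,2)] order_trans by blast
    have "tl_inf p (\<lambda>x. u n x + v n x) (\<mu> n) (\<lambda>x. u' x + v' x) \<nu>
        \<le> Lp_norm p (\<mu> n) (\<lambda>x. (u n x + v n x) - (\<phi> x + \<psi> x))
          + (1 + (K + L)) * tl_inf p (\<lambda>_. 0) (\<mu> n) (\<lambda>_. 0) \<nu>
          + Lp_norm p \<nu> (\<lambda>x. (u' x + v' x) - (\<phi> x + \<psi> x))"
      by (intro tl_inf_le_via_lipschitz[OF p \<mu> \<nu>] Lp_funs_add u v p bounded_lipschitz_add \<phi>(1) \<psi>(1)
          lipschitz_on_add K L)
    also have "Lp_norm p (\<mu> n) (\<lambda>x. (u n x + v n x) - (\<phi> x + \<psi> x))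
        \<le> Lp_norm p (\<mu> n) (\<lambda>x. u n x - \<phi> x) + Lp_norm p (\<mu> n) (\<lambda>x. v n x - \<psi> x)"
      by (rule norm_add[OF \<mu> u(1) v(1)])
    also have "Lp_norm p \<nu> (\<lambda>x. (u' x + v' x) - (\<phi> x + \<psi> x))
        \<le> Lp_norm p \<nu> (\<lambda>x. u' x - \<phi> x) + Lp_norm p \<nu> (\<lambda>x. v' x - \<psi> x)"
      by (rule norm_add[OF \<nu> u(2) v(2)])
    also have "Lp_norm p (\<mu> n) (\<lambda>x. u n x - \<phi> x)
        \<le> Lp_norm p \<nu> (\<lambda>x. u' x - \<phi> x) + (1 + K) * tl_inf p (u n) (\<mu> n) u' \<nu>"
      by (rule Lp_norm_diff_lipschitz_le[OF p \<mu> \<nu> u(1,2) \<phi>(1) K])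
    also have "Lp_norm p (\<mu> n) (\<lambda>x. v n x - \<psi> x)
        \<le> Lp_norm p \<nu> (\<lambda>x. v' x - \<psi> x) + (1 + L) * tl_inf p (v n) (\<mu> n) v' \<nu>"
      by (rule Lp_norm_diff_lipschitz_le[OF p \<mu> \<nu> v(1,2) \<psi>(1) L])
    also have "(1 + K) * tl_inf p (u n) (\<mu> n) u' \<nu> \<le> (1 + K) * t n"
      using nonneg by (intro mult_left_mono le_t) auto
    also have "(1 + L) * tl_inf p (v n) (\<mu> n) v' \<nu> \<le> (1 + L) * t n"
      using nonneg by (intro mult_left_mono le_t) auto
    also have "(1 + (K + L)) * tl_inf p (\<lambda>_. 0) (\<mu> n) (\<lambda>_. 0) \<nu> \<le> (1 + (K + L)) * t n"
      using nonneg by (intro mult_left_mono zero_le_t) auto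
    finally show ?thesis
      using \<phi>(2) \<psi>(2) by (simp add: distrib_right)
  qed
  then show "\<exists>C. \<forall>n. tl_inf p (\<lambda>x. u n x + v n x) (\<mu> n) (\<lambda>x. u' x + v' x) \<nu> \<le> e + C * t n"
    by blast
qed

lemma tl_inf_tendsto_scale:
  assumes u: "\<And>n. u n \<in> Lp_funs p (\<mu> n)" "u' \<in> Lp_funs p \<nu>" "(\<lambda>n. tl_inf p (u n) (\<mu> n) u' \<nu>) \<longlonglongrightarrow> 0"
  shows "(\<lambda>n. tl_inf p (\<lambda>x. c * u n x) (\<mu> n) (\<lambda>x. c * u' x) \<nu>) \<longlonglongrightarrow> 0"
proof (rule tendsto_0_of_approx_bound[OF _ u(3)])
  show "0 \<le> tl_inf p (\<lambda>x. c * u n x) (\<mu> n) (\<lambda>x. c * u' x) \<nu>" for n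
    by (rule tl_inf_nonneg')
  fix e :: real assume "0 < e"
  \<comment> \<open>The error is scaled by |c| and enters twice; the added 1 keeps the denominator
    positive when c = 0.\<close>
  define \<delta> where "\<delta> = e / (2 * \<bar>c\<bar> + 1)"
  have "0 < \<delta>" using \<open>0 < e\<close> by (auto simp: \<delta>_def intro!: divide_pos_pos)
  have \<delta>: "2 * (\<bar>c\<bar> * \<delta>) \<le> e"
    using \<open>0 < e\<close> by (simp add: \<delta>_def field_simps)
  obtain \<phi> where \<phi>: "bounded_lipschitz \<phi>" "Lp_norm p \<nu> (\<lambda>x. u' x - \<phi> x) < \<delta>"
    using lipschitz_dense[OF p \<nu> u(2) \<open>0 < \<delta>\<close>] by auto
  obtain K where K: "K-lipschitz_on UNIV \<phi>"
    using \<phi>(1) by (auto simp: bounded_lipschitz_def)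
  note nonneg = lipschitz_on_nonneg[OF K]
  have norm_scale: "Lp_norm p \<kappa> (\<lambda>x. c * f x - c * \<phi> x) = \<bar>c\<bar> * Lp_norm p \<kappa> (\<lambda>x. f x - \<phi> x)" for \<kappa> f
    by (subst Lp_norm_scale[OF p, symmetric]) (simp add: right_diff_distrib)
  have "tl_inf p (\<lambda>x. c * u n x) (\<mu> n) (\<lambda>x. c * u' x) \<nu>
      \<le> e + (\<bar>c\<bar> * (1 + K) + (1 + \<bar>c\<bar> * K)) * tl_inf p (u n) (\<mu> n) u' \<nu>" for n
  proof -
    have "tl_inf p (\<lambda>x. c * u n x) (\<mu> n) (\<lambda>x. c * u' x) \<nu>
        \<le> Lp_norm p (\<mu> n) (\<lambda>x. c * u n x - c * \<phi> x)
          + (1 + \<bar>c\<bar> * K) * tl_inf p (\<lambda>_. 0) (\<mu> n) (\<lambda>_. 0) \<nu>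
          + Lp_norm p \<nu> (\<lambda>x. c * u' x - c * \<phi> x)"
      by (intro tl_inf_le_via_lipschitz[OF p \<mu> \<nu>] Lp_funs_scale u bounded_lipschitz_cmult \<phi>(1)
          lipschitz_on_cmult_real K)
    also have "Lp_norm p (\<mu> n) (\<lambda>x. c * u n x - c * \<phi> x)
        \<le> \<bar>c\<bar> * (Lp_norm p \<nu> (\<lambda>x. u' x - \<phi> x) + (1 + K) * tl_inf p (u n) (\<mu> n) u' \<nu>)"
      unfolding norm_scale
      by (intro mult_left_mono Lp_norm_diff_lipschitz_le[OF p \<mu> \<nu> u(1,2) \<phi>(1) K]) simp
    also have "(1 + \<bar>c\<bar> * K) * tl_inf p (\<lambda>_. 0) (\<mu> n) (\<lambda>_. 0) \<nu> \<le> (1 + \<bar>c\<bar> * K) * tl_inf p (u n) (\<mu> n) u' \<nu>"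
      using nonneg by (intro mult_left_mono tl_inf_zero_le[OF p \<mu> \<nu> u(1,2)]) auto
    finally have "tl_inf p (\<lambda>x. c * u n x) (\<mu> n) (\<lambda>x. c * u' x) \<nu>
        \<le> 2 * (\<bar>c\<bar> * Lp_norm p \<nu> (\<lambda>x. u' x - \<phi> x))
          + (\<bar>c\<bar> * (1 + K) + (1 + \<bar>c\<bar> * K)) * tl_inf p (u n) (\<mu> n) u' \<nu>"
      unfolding norm_scale by (simp add: algebra_simps)
    moreover have "\<bar>c\<bar> * Lp_norm p \<nu> (\<lambda>x. u' x - \<phi> x) \<le> \<bar>c\<bar> * \<delta>"
      using \<phi>(2) by (intro mult_left_mono) auto
    ultimately show ?thesis using \<delta> by linarith
  qed
  then show "\<exists>C. \<forall>n. tl_inf p (\<lambda>x. c * u n x) (\<mu> n) (\<lambda>x. c * u' x) \<nu> \<le> e + C * tl_inf p (u n) (\<mu> n) u' \<nu>"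
    by blast
qed

lemma tl_inf_tendsto_norm:
  assumes u: "\<And>n. u n \<in> Lp_funs p (\<mu> n)" "u' \<in> Lp_funs p \<nu>" "(\<lambda>n. tl_inf p (u n) (\<mu> n) u' \<nu>) \<longlonglongrightarrow> 0"
  shows "(\<lambda>n. Lp_norm p (\<mu> n) (u n)) \<longlonglongrightarrow> Lp_norm p \<nu> u'"
proof (rule LIM_zero_cancel, rule Lim_null_comparison[OF _ u(3)], rule always_eventually, rule allI)
  fix n
  show "norm (Lp_norm p (\<mu> n) (u n) - Lp_norm p \<nu> u') \<le> tl_inf p (u n) (\<mu> n) u' \<nu>"
    using Lp_norm_le_tl_inf[OF p \<mu>[of n] \<nu> u(1)[of n] u(2)]
      Lp_norm_le_tl_inf[OF p \<nu> \<mu>[of n] u(2) u(1)[of n]]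
      tl_inf_commute[OF p \<mu>[of n] \<nu> u(1)[of n] u(2)]
    unfolding real_norm_def abs_le_iff by linarith
qed

text \<open>A Lipschitz function near u lies in every L^p space of the sequence and has no
  approximation error to itself there, so it is eventually within any prescribed tolerance. The
  choice lemma then turns these approximants, one per tolerance, into one sequence.\<close>

lemma tl_inf_recovery:
  assumes u: "u \<in> Lp_funs p \<nu>" and \<mu>\<nu>: "(\<lambda>n. tl_inf p (\<lambda>_. 0) (\<mu> n) (\<lambda>_. 0) \<nu>) \<longlonglongrightarrow> 0"
  obtains v where "\<And>n. v n \<in> Lp_funs p (\<mu> n)" "(\<lambda>n. tl_inf p (v n) (\<mu> n) u \<nu>) \<longlonglongrightarrow> 0"
proof (rule diagonal_choice)
  show "Lp_funs p (\<mu> n) \<noteq> {}" for n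
    using Lp_funs_zero by blast
  show "0 \<le> tl_inf p v (\<mu> n) u \<nu>" for n v
    by (rule tl_inf_nonneg')
  fix e :: real assume "0 < e"
  obtain \<phi> where \<phi>: "bounded_lipschitz \<phi>" "Lp_norm p \<nu> (\<lambda>x. u x - \<phi> x) < e / 2"
    using lipschitz_dense[OF p \<nu> u, of "e / 2"] \<open>0 < e\<close> by auto
  obtain K where K: "K-lipschitz_on UNIV \<phi>"
    using \<phi>(1) by (auto simp: bounded_lipschitz_def)
  have "(\<lambda>n. (1 + K) * tl_inf p (\<lambda>_. 0) (\<mu> n) (\<lambda>_. 0) \<nu>) \<longlonglongrightarrow> (1 + K) * 0"
    by (intro tendsto_intros \<mu>\<nu>)
  then have "\<forall>\<^sub>F n in sequentially. (1 + K) * tl_inf p (\<lambda>_. 0) (\<mu> n) (\<lambda>_. 0) \<nu> < e / 2"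
    by (rule order_tendstoD) (use \<open>0 < e\<close> in auto)
  then show "\<forall>\<^sub>F n in sequentially. \<exists>v\<in>Lp_funs p (\<mu> n). tl_inf p v (\<mu> n) u \<nu> < e"
  proof eventually_elim
    case (elim n)
    have \<phi>': "\<phi> \<in> Lp_funs p (\<mu> n)"
      by (rule bounded_lipschitz_in_Lp_funs[OF \<mu> \<phi>(1) p])
    have "tl_inf p \<phi> (\<mu> n) u \<nu> < e"
      using tl_inf_le_via_lipschitz[OF p \<mu> \<nu> \<phi>' u \<phi>(1) K] elim \<phi>(2) by (simp add: Lp_norm_def)
    with \<phi>' show ?case by blast
  qed
qed (rule that)

end

section \<open>Assembly of the Banach stacking\<close>

lemma stack_conv_TL_iff:
  assumes p: "1 \<le> p" and j: "\<And>n. j n \<in> prob_measures p \<Omega>" and u: "\<And>n. u n \<in> Lp_funs p (j n)"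
  shows "stack_conv (TL_space p \<Omega>) (TL_dist p \<Omega>) (\<lambda>n. TL_embed (j n)) (\<lambda>n. Lp_class p (j n) (u n))
    \<longleftrightarrow> (\<lambda>n. tl_inf p (u (enat n)) (j (enat n)) (u \<infinity>) (j \<infinity>)) \<longlonglongrightarrow> 0"
proof -
  interpret Metric_space "TL_space p \<Omega>" "TL_dist p \<Omega>" using p by (rule Metric_space_TL)
  show ?thesis
    using j u p
    by (simp add: stack_conv_def limitin_metric_dist_null TL_embed_def TL_space_iff TL_dist_class
        Lp_class_in_carrier)
qed

lemma banach_stacking_seq_Lp:
  assumes p: "1 \<le> p" and j: "\<And>n. j n \<in> prob_measures p \<Omega>"
    and lim: "limitin (wasserstein_topology p \<Omega>) (\<lambda>n. j (enat n)) (j \<infinity>) sequentially"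
  shows "banach_stacking_seq (\<lambda>n. Lp p (j n)) (\<lambda>n. TL_embed (j n)) (TL_space p \<Omega>) (TL_dist p \<Omega>)"
proof -
  interpret Metric_space "TL_space p \<Omega>" "TL_dist p \<Omega>" using p by (rule Metric_space_TL)
  interpret W: Metric_space "prob_measures p \<Omega>" "wasserstein_dist p \<Omega>" using p by (rule Metric_space_wasserstein)
  have W: "(\<lambda>n. tl_inf p (\<lambda>_. 0) (j (enat n)) (\<lambda>_. 0) (j \<infinity>)) \<longlonglongrightarrow> 0"
    using lim by (simp add: wasserstein_topology_def W.limitin_metric_dist_null wasserstein_dist_eq[OF p] j)
  \<comment> \<open>Representatives are fixed for all indices at once, including infinity, so
    convergence of classes becomes a statement about one family of functions.\<close>
  have reps: "\<exists>u. (\<forall>n. u n \<in> Lp_funs p (j n)) \<and> x = (\<lambda>n. Lp_class p (j n) (u n))"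
    if "\<And>n. x n \<in> carrier (Lp p (j n))" for x :: "enat \<Rightarrow> ('a \<Rightarrow> real) set"
    using Lp_rep_in_Lp_funs[OF that] Lp_class_Lp_rep[OF that] by (intro exI[of _ "\<lambda>n. Lp_rep (x n)"]) auto
  note conv_iff = stack_conv_TL_iff[OF p j]
  show ?thesis
  proof (intro banach_stacking_seq.intro banach_stacking_seq_axioms.intro Metric_space_axioms)
    fix n
    show "banach_space (Lp p (j n))" using p by (rule banach_space_Lp)
    show "TL_embed (j n) \<in> carrier (Lp p (j n)) \<rightarrow> TL_space p \<Omega>"
      using j p by (auto simp: TL_embed_def TL_space_iff)
  next
    fix n U V assume "U \<in> carrier (Lp p (j n))" "V \<in> carrier (Lp p (j n))"
    then obtain u v where u: "u \<in> Lp_funs p (j n)" "U = Lp_class p (j n) u"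
      and v: "v \<in> Lp_funs p (j n)" "V = Lp_class p (j n) v"
      by (auto simp: carrier_Lp)
    then show "TL_dist p \<Omega> (TL_embed (j n) U) (TL_embed (j n) V) \<le> nrm (Lp p (j n)) (U \<ominus>\<^bsub>Lp p (j n)\<^esub> V)"
      using tl_inf_same_le[OF p j u(1) v(1)] p j
      by (simp add: TL_embed_def TL_dist_class minus_Lp nrm_Lp_class Lp_funs_diff)
  next
    fix U assume "U \<in> carrier (Lp p (j \<infinity>))"
    then obtain u where u: "u \<in> Lp_funs p (j \<infinity>)" "U = Lp_class p (j \<infinity>) u"
      by (auto simp: carrier_Lp)
    obtain v where v: "\<And>n. v n \<in> Lp_funs p (j (enat n))"
      "(\<lambda>n. tl_inf p (v n) (j (enat n)) u (j \<infinity>)) \<longlonglongrightarrow> 0"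
      using tl_inf_recovery[OF p j j u(1) W] by blast
    define w where "w n = (case n of enat k \<Rightarrow> v k | \<infinity> \<Rightarrow> u)" for n
    have w: "w n \<in> Lp_funs p (j n)" for n
      using v(1) u(1) by (cases n) (auto simp: w_def)
    show "\<exists>x. (\<forall>n. x n \<in> carrier (Lp p (j n))) \<and> x \<infinity> = U
        \<and> stack_conv (TL_space p \<Omega>) (TL_dist p \<Omega>) (\<lambda>n. TL_embed (j n)) x"
      using w v(2) by (intro exI[of _ "\<lambda>n. Lp_class p (j n) (w n)"])
        (auto simp: conv_iff Lp_class_in_carrier u(2), simp_all add: w_def)
  next
    fix x y
    assume x: "\<And>n. x n \<in> carrier (Lp p (j n))" and y: "\<And>n. y n \<in> carrier (Lp p (j n))"
      and conv: "stack_conv (TL_space p \<Omega>) (TL_dist p \<Omega>) (\<lambda>n. TL_embed (j n)) x"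
      "stack_conv (TL_space p \<Omega>) (TL_dist p \<Omega>) (\<lambda>n. TL_embed (j n)) y"
    obtain u v where u: "\<And>n. u n \<in> Lp_funs p (j n)" "x = (\<lambda>n. Lp_class p (j n) (u n))"
      and v: "\<And>n. v n \<in> Lp_funs p (j n)" "y = (\<lambda>n. Lp_class p (j n) (v n))"
      using reps[OF x] reps[OF y] by blast
    show "stack_conv (TL_space p \<Omega>) (TL_dist p \<Omega>) (\<lambda>n. TL_embed (j n)) (\<lambda>n. x n \<oplus>\<^bsub>Lp p (j n)\<^esub> y n)"
      using conv tl_inf_tendsto_add[OF p j j u(1,1) _ v(1,1)]
      by (simp add: u v add_Lp p conv_iff Lp_funs_add)
  next
    fix x and c :: real
    assume x: "\<And>n. x n \<in> carrier (Lp p (j n))"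
      and conv: "stack_conv (TL_space p \<Omega>) (TL_dist p \<Omega>) (\<lambda>n. TL_embed (j n)) x"
    obtain u where u: "\<And>n. u n \<in> Lp_funs p (j n)" "x = (\<lambda>n. Lp_class p (j n) (u n))"
      using reps[OF x] by blast
    show "stack_conv (TL_space p \<Omega>) (TL_dist p \<Omega>) (\<lambda>n. TL_embed (j n)) (\<lambda>n. c \<odot>\<^bsub>Lp p (j n)\<^esub> x n)"
      using conv tl_inf_tendsto_scale[OF p j j u(1,1)]
      by (simp add: u smult_Lp conv_iff Lp_funs_scale)
    show "(\<lambda>n. nrm (Lp p (j (enat n))) (x (enat n))) \<longlonglongrightarrow> nrm (Lp p (j \<infinity>)) (x \<infinity>)"
      using conv tl_inf_tendsto_norm[OF p j j u(1,1)]
      by (simp add: u nrm_Lp_class conv_iff)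
  qed
qed

theorem proposition5p17:
  fixes \<Omega> :: "'a::euclidean_space set" and p :: real
  assumes "open \<Omega>" and "1 \<le> p"
  shows "banach_stacking (wasserstein_topology p \<Omega>) (Lp p) TL_embed (TL_space p \<Omega>) (TL_dist p \<Omega>)"
proof -
  interpret Metric_space "TL_space p \<Omega>" "TL_dist p \<Omega>" using assms(2) by (rule Metric_space_TL)
  have topspace: "topspace (wasserstein_topology p \<Omega>) = prob_measures p \<Omega>"
    using Metric_space.topspace_mtopology[OF Metric_space_wasserstein[OF assms(2)]]
    by (simp add: wasserstein_topology_def)
  show ?thesis
  proof (intro banach_stacking.intro banach_stacking_axioms.intro Metric_space_axioms)
    show "banach_space (Lp p \<mu>)" for \<mu> :: "'a measure"
      using assms(2) by (rule banach_space_Lp)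
    show "TL_embed \<mu> \<in> carrier (Lp p \<mu>) \<rightarrow> TL_space p \<Omega>" if "\<mu> \<in> topspace (wasserstein_topology p \<Omega>)" for \<mu>
      using that assms(2) by (auto simp: topspace TL_embed_def TL_space_iff)
    show "banach_stacking_seq (\<lambda>n. Lp p (j n)) (\<lambda>n. TL_embed (j n)) (TL_space p \<Omega>) (TL_dist p \<Omega>)"
      if "\<And>n. j n \<in> topspace (wasserstein_topology p \<Omega>)"
        "limitin (wasserstein_topology p \<Omega>) (\<lambda>n. j (enat n)) (j \<infinity>) sequentially" for j
      using that by (intro banach_stacking_seq_Lp[OF assms(2)]) (auto simp: topspace)
  qed
qed

end
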